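(* A $\mathcal C^2$-smooth open set $D\subset\mathbb C^n$ is pseudoconvex if and only if it has (at least) one exceptional point.
   Context: An open set $D\subset\mathbb C^n$ is $\mathcal C^2$-smooth if every boundary point $b\in\partial D$ has a neighborhood $U$ with a real-valued $\mathcal C^2$ function $r$ on $U$, with non-vanishing gradient on $\partial D\cap U$, such that $D\cap U=\{z\in U:r(z)<0\}$ and $\partial D\cap U=\{z\in U:r(z)=0\}$. A two-dimensional plane in $\mathbb C^n$ is a complex affine subspace of complex dimension $2$. A point $a\in\mathbb C^n$ is an exceptional point for $D$ if for every two-dimensional plane $P\ni a$, the set $P\cap D$ is empty or pseudoconvex (as an open subset of $P\cong\mathbb C^2$). *)

theory Defs
  imports "HOL-Analysis.Analysis"
begin

definition C2_on :: "('a::real_normed_vector \<Rightarrow> real) \<Rightarrow> 'a set \<Rightarrow> bool" where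
  "C2_on r U \<longleftrightarrow>
     (\<exists>(r' :: 'a \<Rightarrow> 'a \<Rightarrow>\<^sub>L real) (r'' :: 'a \<Rightarrow> 'a \<Rightarrow>\<^sub>L ('a \<Rightarrow>\<^sub>L real)).
        (\<forall>x\<in>U. (r has_derivative blinfun_apply (r' x)) (at x)) \<and>
        (\<forall>x\<in>U. (r' has_derivative blinfun_apply (r'' x)) (at x)) \<and>
        continuous_on U r'')"

text \<open>Smoothness is taken over the reals: the gradient refers to the inner product of
  \<open>complex ^ 'n\<close> as a real Euclidean space.\<close>

definition C2_smooth :: "(complex ^ 'n) set \<Rightarrow> bool" where
  "C2_smooth D \<longleftrightarrow>
     (\<forall>b \<in> frontier D. \<exists>U r. open U \<and> b \<in> U \<and> C2_on r U \<and>
        (\<forall>x \<in> frontier D \<inter> U. \<exists>g. GDERIV r x :> g \<and> g \<noteq> 0) \<and>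
        D \<inter> U = {z \<in> U. r z < 0} \<and>
        frontier D \<inter> U = {z \<in> U. r z = 0})"

text \<open>Plurisubharmonicity of a continuous real-valued function: the sub-mean value inequality
  on every closed affine complex disc contained in the domain.\<close>

definition continuous_psh_on :: "(complex ^ 'n) set \<Rightarrow> (complex ^ 'n \<Rightarrow> real) \<Rightarrow> bool" where
  "continuous_psh_on D u \<longleftrightarrow>
     continuous_on D u \<and>
     (\<forall>z w. (\<forall>\<zeta>\<in>cball 0 1. z + \<zeta> *s w \<in> D) \<longrightarrow>
        u z \<le> 1 / (2 * pi) * integral {0..2 * pi} (\<lambda>t. u (z + cis t *s w)))"

text \<open>Existence of a continuous plurisubharmonic exhaustion function. No connectedness or
  boundedness is required, and the empty set and the whole space are pseudoconvex.\<close>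

definition pseudoconvex :: "(complex ^ 'n) set \<Rightarrow> bool" where
  "pseudoconvex D \<longleftrightarrow>
     open D \<and> (\<exists>u. continuous_psh_on D u \<and> (\<forall>c. compact {z \<in> D. u z \<le> c}))"

text \<open>Here \<open>vec.subspace\<close> and \<open>vec.dim\<close> are taken over the complex numbers.\<close>

definition complex_plane :: "(complex ^ 'n) set \<Rightarrow> bool" where
  "complex_plane P \<longleftrightarrow>
     (\<exists>p V. vec.subspace V \<and> vec.dim V = 2 \<and> P = (\<lambda>v. p + v) ` V)"

text \<open>The identification of a plane with \<open>complex ^ 2\<close> is by a complex affine isomorphism
  \<open>z \<mapsto> p + L z\<close>. Two such identifications of the same plane differ by a complex affine
  automorphism of \<open>complex ^ 2\<close>, which preserves pseudoconvexity, so the choice is immaterial.\<close>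

definition pseudoconvex_in_plane :: "(complex ^ 'n) set \<Rightarrow> (complex ^ 'n) set \<Rightarrow> bool" where
  "pseudoconvex_in_plane P S \<longleftrightarrow>
     (\<exists>p (L :: complex ^ 2 \<Rightarrow> complex ^ 'n).
        Vector_Spaces.linear (*s) (*s) L \<and> bij_betw (\<lambda>z. p + L z) UNIV P \<and>
        pseudoconvex {z. p + L z \<in> S})"

definition exceptional_point :: "complex ^ 'n \<Rightarrow> (complex ^ 'n) set \<Rightarrow> bool" where
  "exceptional_point a D \<longleftrightarrow>
     (\<forall>P. complex_plane P \<and> a \<in> P \<longrightarrow> P \<inter> D = {} \<or> pseudoconvex_in_plane P (P \<inter> D))"

end

theory Submission
  imports Defs "HOL-Computational_Algebra.Polynomial"
begin

text \<open>A pseudoconvex set restricts to pseudoconvex plane sections, so every point is exceptional.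
  Conversely, if \<open>- ln dist(z, \<partial>D)\<close> is not plurisubharmonic, comparing it with a harmonic polynomial
  produces a quadratic holomorphic disc that touches \<open>\<partial>D\<close> from inside to second order, that is, a
  boundary point \<open>b\<close> with a negative Levi form in a complex tangent direction \<open>w\<close>. If \<open>b - a\<close> is not
  complex tangent at \<open>b\<close>, the plane through \<open>a\<close> spanned by \<open>b - a\<close> and \<open>w\<close> cuts \<open>D\<close> in a set that
  violates the continuity principle, so \<open>a\<close> is not exceptional. Otherwise \<open>\<partial>D\<close> is, near \<open>b\<close>, a cone
  with vertex \<open>a\<close>. Dilation by \<open>\<lambda>\<close> towards \<open>a\<close> multiplies the normalised Levi form by \<open>1 / \<lambda>\<close>, which
  lets one push \<open>b\<close> towards \<open>a\<close> until the Levi form would have to blow up at \<open>a\<close>.\<close>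

section \<open>Circle averages and failure of the sub-mean value inequality\<close>

text \<open>Complex tangency of \<open>b - a\<close> at the single point \<open>b\<close> has no
  geometric consequence. What helps is that negativity of the Levi form is an open condition: the
  transversal case is excluded at every boundary point near \<open>b\<close>, so the radial
  derivative of a defining function vanishes on a whole piece of \<open>frontier D\<close>, and this
  forces the cone. The passage from the boundary to a neighbourhood is made by a differential
  inequality. Pushing \<open>b\<close> towards \<open>a\<close> leaves the chart of
  \<open>b\<close>, and Levi forms at distant points refer to different defining functions.
  Curvature is therefore recorded by \<open>inner_disc\<close>, which mentions only
  \<open>D\<close>. A dilation keeps the direction \<open>w\<close>, so one fixed \<open>w\<close>
  serves at all points and survives limits, and it preserves the product of the curvature constant
  and the distance to \<open>a\<close>. At a limit point equal to \<open>a\<close> continuity of the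
  second derivative would make this product 0; at any other limit point the cone allows a further
  step. For the same reason the argument must start at a boundary point different from
  \<open>a\<close>.\<close>

lemma norm_smult_vec: "norm (c *s (x :: complex ^ 'n)) = norm c * norm x"
  by (simp add: norm_vec_def norm_mult L2_set_right_distrib)

lemma bounded_bilinear_smult: "bounded_bilinear ((*s) :: complex \<Rightarrow> complex ^ 'n \<Rightarrow> complex ^ 'n)"
proof
  show "\<exists>K. \<forall>a b. norm (a *s b :: complex ^ 'n) \<le> norm a * norm b * K"
    by (intro exI[of _ 1]) (simp add: norm_smult_vec)
qed (vector field_simps scaleR_conv_of_real)+

lemmas smult_continuous [continuous_intros] =
  bounded_bilinear.continuous_on[OF bounded_bilinear_smult]

lemma smult_of_real: "complex_of_real s *s (x :: complex ^ 'n) = s *\<^sub>R x"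
  by (vector scaleR_conv_of_real)

lemma inner_ii_smult_self: "inner (\<i> *s (x :: complex ^ 'n)) x = 0"
  by (simp add: inner_vec_def inner_complex_def algebra_simps)

text \<open>The mean value property: of all monomials only the constant one survives integration
  over the circle. Harmonic functions enter the proof only as real parts of polynomials.\<close>

lemma has_integral_Re_poly_circle:
  fixes p :: "complex poly"
  shows "((\<lambda>t. Re (poly p (cis t))) has_integral 2 * pi * Re (poly p 0)) {0..2 * pi}"
proof -
  have mono: "((\<lambda>t. c * cis t ^ k) has_integral (if k = 0 then 2 * pi * c else 0)) {0..2 * pi}" for c :: complex and k
  proof (cases "k = 0")
    case True
    then show ?thesis
      using has_integral_const_real[of c 0 "2 * pi"] by (simp add: scaleR_conv_of_real)
  next
    case False
    define F where "F = (\<lambda>t. c * cis (real k * t) / (\<i> * of_nat k))"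
    have "((\<lambda>t. c * cis (real k * t)) has_integral (F (2 * pi) - F 0)) {0..2 * pi}"
    proof (rule fundamental_theorem_of_calculus)
      fix x :: real
      have "((\<lambda>t. cis (real k * t)) has_vector_derivative (real k * 1) *\<^sub>R (\<i> * cis (real k * x))) (at x within {0..2*pi})"
        unfolding has_vector_derivative_def
        by (rule has_derivative_eq_rhs[OF has_derivative_cis[of "\<lambda>t. real k * t" "\<lambda>h. real k * h"]])
          (auto intro!: derivative_eq_intros simp: fun_eq_iff scaleR_conv_of_real)
      then have "((\<lambda>t. c / (\<i> * of_nat k) * cis (real k * t)) has_vector_derivative
          c / (\<i> * of_nat k) * ((real k * 1) *\<^sub>R (\<i> * cis (real k * x)))) (at x within {0..2*pi})"
        by (rule has_vector_derivative_mult_right)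
      then show "(F has_vector_derivative c * cis (real k * x)) (at x within {0..2 * pi})"
        using False unfolding F_def by (simp add: scaleR_conv_of_real field_simps)
    qed simp
    moreover have "F (2 * pi) = F 0"
    proof -
      have "cis (real k * (2 * pi)) = 1"
        using cis_multiple_2pi[of "real k"] by (simp add: mult_ac)
      then show ?thesis by (simp add: F_def)
    qed
    ultimately have "((\<lambda>t. c * cis (real k * t)) has_integral 0) {0..2 * pi}" by simp
    then show ?thesis using False by (simp only: Complex.DeMoivre if_False)
  qed
  have "((\<lambda>t. poly p (cis t)) has_integral (\<Sum>k\<le>degree p. if k = 0 then 2 * pi * coeff p k else 0)) {0..2 * pi}"
    unfolding poly_altdef by (intro has_integral_sum mono) simp
  also have "(\<Sum>k\<le>degree p. if k = 0 then 2 * pi * coeff p k else 0) = 2 * pi * poly p 0"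
    by (simp add: poly_0_coeff_0)
  finally have "((\<lambda>t. Re (poly p (cis t))) has_integral Re (2 * pi * poly p 0)) {0..2 * pi}"
    by (rule has_integral_linear[OF _ bounded_linear_Re, unfolded o_def])
  then show ?thesis by simp
qed

text \<open>On the unit circle \<open>cnj z * z = 1\<close>, so the product is a Laurent polynomial,
  and under \<open>Re\<close> its negative powers may be conjugated into positive ones. Removing the
  constant coefficients of \<open>p\<close> and \<open>q\<close> together leaves a product of the
  same kind, which drives the induction.\<close>

lemma Re_cnj_poly_mult_on_circle:
  fixes p q :: "complex poly"
  shows "\<exists>s. \<forall>z. norm z = 1 \<longrightarrow> Re (cnj (poly p z) * poly q z) = Re (poly s z)"
proof (induction p arbitrary: q)
  case 0
  show ?case by (intro exI[of _ 0]) simp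
next
  case (pCons a p)
  obtain b q' where q: "q = pCons b q'" by (cases q)
  obtain s where s: "\<And>z. norm z = 1 \<Longrightarrow> Re (cnj (poly p z) * poly q' z) = Re (poly s z)"
    using pCons.IH by blast
  have "Re (cnj (poly (pCons a p) z) * poly q z) =
      Re (poly (smult (cnj a) q + s + smult (cnj b) (pCons 0 p)) z)" if z: "norm z = 1" for z
  proof -
    have zz: "cnj z * z = 1"
      using z complex_norm_square[of z] by (simp add: mult.commute)
    have "cnj (poly (pCons a p) z) * poly q z
        = cnj a * poly q z + cnj (poly p z) * (cnj z * z) * poly q' z + b * cnj z * cnj (poly p z)"
      by (simp add: q algebra_simps)
    also have "b * cnj z * cnj (poly p z) = cnj (cnj b * z * poly p z)"
      by simp
    also have "Re (cnj a * poly q z + cnj (poly p z) * (cnj z * z) * poly q' z + cnj (cnj b * z * poly p z))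
        = Re (cnj a * poly q z) + Re (cnj (poly p z) * poly q' z) + Re (cnj b * z * poly p z)"
      by (simp only: zz plus_complex.simps cnj.simps mult_1_right)
    finally show ?thesis by (simp only: s[OF z]) (simp add: algebra_simps)
  qed
  then show ?case by blast
qed

text \<open>Prepares the approximants of Stone-Weierstrass. Products are the only difficulty;
  \<open>2 * (Re x * Re y) = Re (x * y) + Re (cnj x * y)\<close> reduces them to the preceding
  lemma.\<close>

lemma real_polynomial_function_eq_Re_poly_on_circle:
  fixes f :: "complex \<Rightarrow> real"
  assumes "real_polynomial_function f"
  shows "\<exists>p. \<forall>z. norm z = 1 \<longrightarrow> f z = Re (poly p z)"
  using assms
proof (induction rule: real_polynomial_function.induct)
  case (linear f)
  have "f z = Re (poly [:0, Complex (f 1) (- f \<i>):] z)" for z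
  proof -
    have "f z = f (Re z *\<^sub>R 1 + Im z *\<^sub>R \<i>)"
      by (rule arg_cong[of _ _ f]) (simp add: complex_eq_iff)
    also have "\<dots> = Re z * f 1 + Im z * f \<i>"
      using linear by (simp add: bounded_linear.linear linear_add linear_scale)
    finally show ?thesis by simp
  qed
  then show ?case by blast
next
  case (const c)
  show ?case by (intro exI[of _ "[:of_real c:]"]) simp
next
  case (add f g)
  then obtain p q where "\<And>z. norm z = 1 \<Longrightarrow> f z = Re (poly p z)" "\<And>z. norm z = 1 \<Longrightarrow> g z = Re (poly q z)"
    by blast
  then show ?case by (intro exI[of _ "p + q"]) simp
next
  case (mult f g)
  then obtain p q where pq: "\<And>z. norm z = 1 \<Longrightarrow> f z = Re (poly p z)" "\<And>z. norm z = 1 \<Longrightarrow> g z = Re (poly q z)"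
    by blast
  obtain s where s: "\<And>z. norm z = 1 \<Longrightarrow> Re (cnj (poly p z) * poly q z) = Re (poly s z)"
    using Re_cnj_poly_mult_on_circle by blast
  have "Re x * Re y = Re (x * y) / 2 + Re (cnj x * y) / 2" for x y
    by (simp add: add_divide_distrib[symmetric])
  then have "f z * g z = Re (poly (smult (1/2) (p * q + s)) z)" if "norm z = 1" for z
    using pq[OF that] s[OF that] by (simp add: field_simps)
  then show ?case by blast
qed

text \<open>Stands in for solving the Dirichlet problem: harmonic polynomials are dense in the
  continuous functions on the circle.\<close>

lemma Re_poly_approx_on_circle:
  fixes f :: "complex \<Rightarrow> real"
  assumes "continuous_on (sphere 0 1) f" "e > 0"
  obtains p where "\<And>z. norm z = 1 \<Longrightarrow> \<bar>f z - Re (poly p z)\<bar> < e"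
proof -
  obtain g where g: "real_polynomial_function g" "\<And>z. z \<in> sphere 0 1 \<Longrightarrow> \<bar>f z - g z\<bar> < e"
    using Stone_Weierstrass_real_polynomial_function[OF compact_sphere assms] by blast
  obtain p where "\<And>z. norm z = 1 \<Longrightarrow> g z = Re (poly p z)"
    using real_polynomial_function_eq_Re_poly_on_circle[OF g(1)] by blast
  with g(2) that[of p] show ?thesis by simp
qed

text \<open>If \<open>h\<close> is a harmonic polynomial slightly above \<open>u\<close> on the circle, then \<open>u - h + \<epsilon> \<bar>\<zeta>\<bar>\<^sup>2\<close>
  has an interior maximum.\<close>

lemma sub_mean_value_failure_touch:
  fixes u :: "complex \<Rightarrow> real"
  assumes cont: "continuous_on (cball 0 1) u"
    and less: "1 / (2 * pi) * integral {0..2 * pi} (\<lambda>t. u (cis t)) < u 0"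
  obtains \<zeta> A B \<epsilon> \<eta> where "norm \<zeta> < 1" "\<epsilon> > 0" "\<eta> > 0"
    "\<And>\<tau>. norm \<tau> < \<eta> \<Longrightarrow> u (\<zeta> + \<tau>) \<le> u \<zeta> + Re (A * \<tau> + B * \<tau>\<^sup>2) - \<epsilon> * (norm \<tau>)\<^sup>2"
proof -
  define I where "I = 1 / (2 * pi) * integral {0..2 * pi} (\<lambda>t. u (cis t))"
  \<comment> \<open>Of the gap \<open>5 * e\<close>, the approximation costs \<open>e\<close> at the
    centre and \<open>e\<close> on the circle, and the added \<open>e * (norm z)\<^sup>2\<close>
    costs another \<open>e\<close> on the circle. There \<open>f\<close> is at most
    \<open>2 * e\<close>, whereas \<open>f 0\<close> is at least \<open>4 * e\<close>, so the
    maximum of \<open>f\<close> is interior.\<close>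
  define e where "e = (u 0 - I) / 5"
  have "u 0 - I = 5 * e" by (simp add: e_def)
  have e: "e > 0" using less by (simp add: e_def I_def)
  have conts: "continuous_on (sphere 0 1) u"
    using cont by (rule continuous_on_subset) auto
  obtain p where p: "\<And>z. norm z = 1 \<Longrightarrow> \<bar>u z - Re (poly p z)\<bar> < e"
    using Re_poly_approx_on_circle[OF conts e] by blast
  have intu: "(\<lambda>t. u (cis t)) integrable_on {0..2 * pi}"
    by (intro integrable_continuous_interval continuous_on_compose2[OF conts] continuous_intros)
      (auto simp: continuous_on_cis)
  have "2 * pi * Re (poly p 0) = integral {0..2 * pi} (\<lambda>t. Re (poly p (cis t)))"
    using has_integral_Re_poly_circle[of p] by (simp add: integral_unique)
  also have "\<dots> \<le> integral {0..2 * pi} (\<lambda>t. u (cis t) + e)"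
  proof (rule integral_le)
    show "Re (poly p (cis t)) \<le> u (cis t) + e" for t
      using p[of "cis t"] by simp
  qed (use intu has_integral_Re_poly_circle in \<open>auto intro!: integrable_add\<close>)
  also have "\<dots> = 2 * pi * I + 2 * pi * e"
    using integral_add[OF intu integrable_const_ivl[of e]] by (simp add: I_def)
  finally have "2 * pi * Re (poly p 0) \<le> 2 * pi * (I + e)"
    by (simp add: algebra_simps)
  then have p0: "Re (poly p 0) \<le> I + e" by simp
  define f where "f = (\<lambda>z. u z - Re (poly p z) + e * (norm z)\<^sup>2)"
  have "continuous_on (cball 0 1) f"
    unfolding f_def by (intro continuous_intros cont)
  then obtain \<zeta> where \<zeta>: "\<zeta> \<in> cball 0 1" "\<And>z. z \<in> cball 0 1 \<Longrightarrow> f z \<le> f \<zeta>"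
    using continuous_attains_sup[of "cball 0 1" f] by (auto simp: compact_cball)
  have "norm \<zeta> \<noteq> 1"
  proof
    assume n: "norm \<zeta> = 1"
    have "f \<zeta> \<le> 2 * e" using p[OF n] n by (simp add: f_def)
    moreover have "f 0 \<ge> 4 * e" using p0 \<open>u 0 - I = 5 * e\<close> unfolding f_def by simp
    ultimately show False using \<zeta>(2)[of 0] e by simp
  qed
  then have n\<zeta>: "norm \<zeta> < 1" using \<zeta>(1) by simp
  \<comment> \<open>Taylor expansion of \<open>p\<close> about \<zeta>, read off from the translated
    polynomial; \<open>q\<close> carries the cubic remainder.\<close>
  obtain c0 c1 c2 q where q: "pcompose p [:\<zeta>, 1:] = pCons c0 (pCons c1 (pCons c2 q))"
    by (metis pCons_cases)
  have exp: "poly p (\<zeta> + \<tau>) = poly p \<zeta> + c1 * \<tau> + c2 * \<tau>\<^sup>2 + \<tau> ^ 3 * poly q \<tau>" for \<tau>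
  proof -
    have *: "poly p (\<zeta> + \<tau>) = c0 + \<tau> * (c1 + \<tau> * (c2 + \<tau> * poly q \<tau>))" for \<tau>
      using arg_cong[OF q, of "\<lambda>P. poly P \<tau>"] by (simp add: poly_pcompose)
    have "poly p \<zeta> = c0" using *[of 0] by simp
    with *[of \<tau>] show ?thesis by (simp add: algebra_simps power2_eq_square power3_eq_cube)
  qed
  have "isCont (\<lambda>\<tau>. norm (\<tau> * poly q \<tau>)) 0" by (intro continuous_intros)
  then have "\<forall>\<^sub>F \<tau> in at 0. norm (\<tau> * poly q \<tau>) < e / 2"
    by (intro order_tendstoD) (use e in \<open>auto simp: isCont_def\<close>)
  then obtain d where d: "d > 0" "\<And>\<tau>. \<tau> \<noteq> 0 \<Longrightarrow> norm \<tau> < d \<Longrightarrow> norm (\<tau> * poly q \<tau>) < e / 2"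
    by (auto simp: eventually_at dist_norm)
  \<comment> \<open>The correction of \<open>c1\<close> comes from expanding
    \<open>e * (norm (\<zeta> + \<tau>))\<^sup>2\<close>; half of the quadratic gain is spent on the
    cubic remainder.\<close>
  have "u (\<zeta> + \<tau>) \<le> u \<zeta> + Re ((c1 - 2 * e * cnj \<zeta>) * \<tau> + c2 * \<tau>\<^sup>2) - (e/2) * (norm \<tau>)\<^sup>2"
    if t: "norm \<tau> < min d (1 - norm \<zeta>)" for \<tau>
  proof -
    have "norm (\<zeta> + \<tau>) \<le> 1" using norm_triangle_ineq[of \<zeta> \<tau>] t by simp
    then have 1: "f (\<zeta> + \<tau>) \<le> f \<zeta>" using \<zeta>(2) by simp
    have 2: "Re (\<tau> ^ 3 * poly q \<tau>) \<le> (e/2) * (norm \<tau>)\<^sup>2"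
    proof (cases "\<tau> = 0")
      case False
      have "Re (\<tau> ^ 3 * poly q \<tau>) \<le> norm (\<tau>\<^sup>2 * (\<tau> * poly q \<tau>))"
        using complex_Re_le_cmod[of "\<tau> ^ 3 * poly q \<tau>"]
        by (simp add: power2_eq_square power3_eq_cube mult.assoc)
      also have "\<dots> \<le> (norm \<tau>)\<^sup>2 * (e/2)"
        unfolding norm_mult[of "\<tau>\<^sup>2"] norm_power
        by (intro mult_left_mono less_imp_le d(2)) (use False t in auto)
      finally show ?thesis by (simp add: mult.commute)
    qed simp
    have 3: "(norm (\<zeta> + \<tau>))\<^sup>2 = (norm \<zeta>)\<^sup>2 + 2 * Re (cnj \<zeta> * \<tau>) + (norm \<tau>)\<^sup>2"
      unfolding cmod_power2 by (simp add: power2_eq_square algebra_simps)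
    have "e * (norm (\<zeta> + \<tau>))\<^sup>2 = e * (norm \<zeta>)\<^sup>2 + Re (2 * e * cnj \<zeta> * \<tau>) + e * (norm \<tau>)\<^sup>2"
      unfolding 3 by (simp add: algebra_simps)
    moreover have "Re ((c1 - 2 * e * cnj \<zeta>) * \<tau> + c2 * \<tau>\<^sup>2) = Re (c1 * \<tau>) - Re (2 * e * cnj \<zeta> * \<tau>) + Re (c2 * \<tau>\<^sup>2)"
      by (simp add: algebra_simps)
    ultimately show ?thesis
      using 1 2 unfolding f_def exp by (simp add: algebra_simps)
  qed
  then show thesis
    using that[of \<zeta> "e/2" "min d (1 - norm \<zeta>)" "c1 - 2 * e * cnj \<zeta>" c2] n\<zeta> e d(1) by auto
qed

section \<open>Quadratic discs touching the boundary\<close>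

text \<open>Second-order contact of a holomorphic disc with the boundary from inside, its strength
  measured by the surrounding balls. In a C2 chart, having such discs for all positive constants
  below some \<open>c > 0\<close> means that \<open>w\<close> is complex tangent at \<open>b\<close>
  and \<open>Levi b w \<le> - 4 * c * norm (r' b)\<close>. No defining function occurs, so points in
  different charts can be compared.\<close>

definition inner_disc :: "(complex ^ 'n) set \<Rightarrow> real \<Rightarrow> complex ^ 'n \<Rightarrow> complex ^ 'n \<Rightarrow> bool" where
  "inner_disc D c b w \<longleftrightarrow>
     (\<exists>q \<eta>. \<eta> > 0 \<and>
        (\<forall>\<tau>. \<tau> \<noteq> 0 \<and> norm \<tau> < \<eta> \<longrightarrow> ball (b + \<tau> *s w + \<tau>\<^sup>2 *s q) (c * (norm \<tau>)\<^sup>2) \<subseteq> D))"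

lemma inner_disc_antimono:
  assumes "inner_disc D c b w" "c' \<le> c"
  shows "inner_disc D c' b w"
proof -
  have "ball x (c' * (norm \<tau>)\<^sup>2) \<subseteq> ball x (c * (norm \<tau>)\<^sup>2)" for x :: "complex ^ 'n" and \<tau> :: complex
    using assms(2) by (intro subset_ball mult_right_mono) auto
  with assms(1) show ?thesis unfolding inner_disc_def by (meson subset_trans)
qed

lemma ball_infdist_subset:
  fixes D :: "'a::metric_space set"
  assumes "D \<noteq> UNIV"
  shows "ball x (infdist x (- D)) \<subseteq> D"
proof
  fix y assume "y \<in> ball x (infdist x (- D))"
  then show "y \<in> D"
    using infdist_le[of y "- D" x] by force
qed

lemma infdist_Compl_pos:
  assumes "open D" "D \<noteq> UNIV" "x \<in> D"
  shows "infdist x (- D) > 0"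
  using infdist_pos_not_in_closed[of "- D" x] assms by auto

text \<open>The disc obtained from the distance function carries an exponential factor. Its 2-jet
  replaces it, and the error must be a small multiple of |\<tau>|^2 to be covered by the strict gain
  at the point of touching.\<close>

lemma exp_quadratic_approx:
  fixes A B :: complex
  assumes "e > 0"
  obtains d where "d > 0" "\<And>\<tau>. norm \<tau> < d \<Longrightarrow>
     norm (exp (- (A * \<tau> + B * \<tau>\<^sup>2)) - (1 - A * \<tau> + (A\<^sup>2 / 2 - B) * \<tau>\<^sup>2)) \<le> e * (norm \<tau>)\<^sup>2"
proof -
  \<comment> \<open>The first two summands are the cubic and quartic coefficients left over from
    \<open>1 + s + s\<^sup>2 / 2\<close>; the last one bounds the remainder of the exponential
    series.\<close>
  define R where "R = norm (A * B) + (norm B)\<^sup>2 / 2 + exp (norm A + norm B) * (norm A + norm B) ^ 3"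
  have R: "R \<ge> 0" by (simp add: R_def)
  define d where "d = min 1 (e / (R + 1))"
  have d: "d > 0" using assms R by (simp add: d_def)
  moreover have "norm (exp (- (A * \<tau> + B * \<tau>\<^sup>2)) - (1 - A * \<tau> + (A\<^sup>2 / 2 - B) * \<tau>\<^sup>2)) \<le> e * (norm \<tau>)\<^sup>2"
    if t: "norm \<tau> < d" for \<tau>
  proof -
    define s where "s = - (A * \<tau> + B * \<tau>\<^sup>2)"
    have t1: "norm \<tau> \<le> 1" using t by (simp add: d_def)
    have t2: "(norm \<tau>) ^ 4 \<le> (norm \<tau>) ^ 3" using t1 by (intro power_decreasing) auto
    have "norm s \<le> norm A * norm \<tau> + norm B * (norm \<tau>)\<^sup>2"
      unfolding s_def norm_minus_cancel
      by (rule order_trans[OF norm_triangle_ineq]) (simp add: norm_mult norm_power)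
    also have "\<dots> \<le> norm A * norm \<tau> + norm B * norm \<tau>"
      using t1 by (intro add_left_mono mult_left_mono) (auto simp: power2_eq_square mult_left_le)
    finally have s: "norm s \<le> (norm A + norm B) * norm \<tau>" by (simp add: algebra_simps)
    also have "\<dots> \<le> norm A + norm B" using t1 by (intro mult_left_le) auto
    finally have s1: "norm s \<le> norm A + norm B" .
    have "norm (exp s - (1 + s + s\<^sup>2 / 2)) \<le> exp \<bar>Re s\<bar> * norm s ^ 3 / 2"
      using Taylor_exp[of s 2] by (simp add: numeral_2_eq_2 numeral_3_eq_3)
    also have "\<dots> \<le> exp (norm A + norm B) * ((norm A + norm B) * norm \<tau>) ^ 3 / 2"
      using s s1 abs_Re_le_cmod[of s]
      by (intro divide_right_mono mult_mono power_mono) auto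
    also have "\<dots> \<le> exp (norm A + norm B) * (norm A + norm B) ^ 3 * norm \<tau> ^ 3"
      by (simp add: power_mult_distrib)
    finally have 1: "norm (exp s - (1 + s + s\<^sup>2 / 2)) \<le> exp (norm A + norm B) * (norm A + norm B) ^ 3 * norm \<tau> ^ 3" .
    have "1 + s + s\<^sup>2 / 2 - (1 - A * \<tau> + (A\<^sup>2 / 2 - B) * \<tau>\<^sup>2) = A * B * \<tau> ^ 3 + B\<^sup>2 / 2 * \<tau> ^ 4"
      by (simp add: s_def field_simps power2_eq_square power3_eq_cube power4_eq_xxxx)
    then have "norm (1 + s + s\<^sup>2 / 2 - (1 - A * \<tau> + (A\<^sup>2 / 2 - B) * \<tau>\<^sup>2))
        \<le> norm (A * B * \<tau> ^ 3) + norm (B\<^sup>2 / 2 * \<tau> ^ 4)"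
      by (simp only: norm_triangle_ineq)
    also have "\<dots> = norm (A * B) * norm \<tau> ^ 3 + (norm B)\<^sup>2 / 2 * norm \<tau> ^ 4"
      by (simp add: norm_mult norm_power norm_divide)
    also have "\<dots> \<le> norm (A * B) * norm \<tau> ^ 3 + (norm B)\<^sup>2 / 2 * norm \<tau> ^ 3"
      using t2 by (intro add_left_mono mult_left_mono) auto
    finally have "norm (exp s - (1 - A * \<tau> + (A\<^sup>2 / 2 - B) * \<tau>\<^sup>2)) \<le> R * norm \<tau> ^ 3"
      using 1 norm_triangle_ineq[of "exp s - (1 + s + s\<^sup>2 / 2)" "1 + s + s\<^sup>2 / 2 - (1 - A * \<tau> + (A\<^sup>2 / 2 - B) * \<tau>\<^sup>2)"]
      by (simp add: R_def algebra_simps)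
    also have "\<dots> = (R * norm \<tau>) * (norm \<tau>)\<^sup>2" by (simp add: power2_eq_square power3_eq_cube)
    also have "\<dots> \<le> e * (norm \<tau>)\<^sup>2"
    proof (rule mult_right_mono)
      have "R * norm \<tau> \<le> (R + 1) * (e / (R + 1))"
        using t R assms by (intro mult_mono) (auto simp: d_def)
      then show "R * norm \<tau> \<le> e" using R by simp
    qed simp
    finally show ?thesis by (simp add: s_def)
  qed
  ultimately show thesis using that by blast
qed

text \<open>Let \<open>b\<close> be a boundary point nearest to the point \<open>x\<close> of
  touching, and \<open>a = b - x\<close>. Exponentiated, the touching inequality says that the
  boundary distance at \<open>x + \<tau> *s w\<close> exceeds the norm of
  \<open>E \<tau> *s a\<close> by a multiple of |\<tau>|^2. Translating by the holomorphic
  \<open>E \<tau> *s a\<close> thus stays in \<open>D\<close> with room to spare for \<tau> other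
  than 0, and lands on \<open>b\<close> for \<tau> = 0.\<close>

lemma inner_disc_of_not_psh:
  fixes D :: "(complex ^ 'n) set"
  assumes D: "open D" "D \<noteq> UNIV"
    and sub: "\<And>\<zeta>. \<zeta> \<in> cball 0 1 \<Longrightarrow> z + \<zeta> *s w \<in> D"
    and fail: "1 / (2 * pi) * integral {0..2 * pi} (\<lambda>t. - ln (infdist (z + cis t *s w) (- D))) < - ln (infdist z (- D))"
  obtains b c v where "b \<in> frontier D" "c > 0" "inner_disc D c b v"
proof -
  define \<delta> where "\<delta> = (\<lambda>x. infdist x (- D))"
  have pos: "\<delta> x > 0" if "x \<in> D" for x using infdist_Compl_pos D that by (simp add: \<delta>_def)
  define u where "u = (\<lambda>\<zeta>. - ln (\<delta> (z + \<zeta> *s w)))"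
  have contu: "continuous_on (cball 0 1) u"
  proof -
    have "\<delta> (z + \<zeta> *s w) \<noteq> 0" if "\<zeta> \<in> cball 0 1" for \<zeta>
      using pos[OF sub[OF that]] by simp
    then show ?thesis unfolding u_def \<delta>_def by (intro continuous_intros ballI)
  qed
  have "1 / (2 * pi) * integral {0..2 * pi} (\<lambda>t. u (cis t)) < u 0"
    using fail by (simp add: u_def \<delta>_def)
  then obtain \<zeta> A B \<epsilon> \<eta> where n: "norm \<zeta> < 1" "\<epsilon> > 0" "\<eta> > 0"
    and touch: "\<And>\<tau>. norm \<tau> < \<eta> \<Longrightarrow> u (\<zeta> + \<tau>) \<le> u \<zeta> + Re (A * \<tau> + B * \<tau>\<^sup>2) - \<epsilon> * (norm \<tau>)\<^sup>2"
    by (rule sub_mean_value_failure_touch[OF contu]) (rule that; assumption)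
  define x where "x = z + \<zeta> *s w"
  have xD: "x \<in> D" using sub[of \<zeta>] n by (simp add: x_def)
  have ne: "- D \<noteq> {}" using D by auto
  obtain b where b: "b \<in> - D" "\<delta> x = dist x b"
    using infdist_attains_inf[OF _ ne, of x] D by (auto simp: \<delta>_def)
  define a where "a = b - x"
  have na: "norm a = \<delta> x" using b by (simp add: a_def dist_norm norm_minus_commute)
  have a0: "norm a > 0" using pos[OF xD] na by simp
  have "b \<in> closure D"
  proof -
    have "b \<in> cball x (\<delta> x)" using b by simp
    also have "\<dots> = closure (ball x (\<delta> x))" using pos[OF xD] by simp
    also have "\<dots> \<subseteq> closure D" unfolding \<delta>_def by (intro closure_mono ball_infdist_subset D)
    finally show ?thesis .
  qed
  then have bf: "b \<in> frontier D" using b D by (simp add: frontier_def interior_open)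
  \<comment> \<open>As \<open>norm (E \<tau>) > 1 / 2\<close>, the available room is at least
    \<open>2 * c * (norm \<tau>)\<^sup>2\<close>; replacing \<open>E\<close> by its 2-jet uses up
    one half, and the other half is the radius of the ball.\<close>
  define c where "c = norm a * \<epsilon> / 4"
  have c: "c > 0" using a0 n by (simp add: c_def)
  define E where "E = (\<lambda>\<tau>. exp (- (A * \<tau> + B * \<tau>\<^sup>2)))"
  obtain d1 where d1: "d1 > 0" "\<And>\<tau>. norm \<tau> < d1 \<Longrightarrow>
     norm (E \<tau> - (1 - A * \<tau> + (A\<^sup>2 / 2 - B) * \<tau>\<^sup>2)) \<le> \<epsilon> / 4 * (norm \<tau>)\<^sup>2"
    using exp_quadratic_approx[of "\<epsilon> / 4" A B] n unfolding E_def by auto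
  have "isCont (\<lambda>\<tau>. norm (E \<tau>)) 0" unfolding E_def by (intro continuous_intros)
  then have "\<forall>\<^sub>F \<tau> in at 0. norm (E \<tau>) > 1 / 2"
    by (intro order_tendstoD) (auto simp: isCont_def E_def)
  then obtain d2 where d2: "d2 > 0" "\<And>\<tau>. \<tau> \<noteq> 0 \<Longrightarrow> norm \<tau> < d2 \<Longrightarrow> norm (E \<tau>) > 1 / 2"
    by (auto simp: eventually_at dist_norm)
  define \<eta>' where "\<eta>' = Min {\<eta>, d1, d2, 1 - norm \<zeta>}"
  have "ball (b + \<tau> *s (w - A *s a) + \<tau>\<^sup>2 *s ((A\<^sup>2 / 2 - B) *s a)) (c * (norm \<tau>)\<^sup>2) \<subseteq> D"
    if t: "\<tau> \<noteq> 0" "norm \<tau> < \<eta>'" for \<tau>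
  proof -
    have t': "norm \<tau> < \<eta>" "norm \<tau> < d1" "norm \<tau> < d2" "norm \<tau> < 1 - norm \<zeta>"
      using t by (auto simp: \<eta>'_def)
    define y where "y = x + \<tau> *s w"
    have y: "y = z + (\<zeta> + \<tau>) *s w" by (simp add: y_def x_def vector_sadd_rdistrib)
    have yD: "y \<in> D" unfolding y
      using sub[of "\<zeta> + \<tau>"] t'(4) norm_triangle_ineq[of \<zeta> \<tau>] by simp
    have "- ln (\<delta> y) \<le> - ln (\<delta> x) + Re (A * \<tau> + B * \<tau>\<^sup>2) - \<epsilon> * (norm \<tau>)\<^sup>2"
      using touch[OF t'(1)] by (simp add: u_def y x_def)
    then have "ln (\<delta> x) - Re (A * \<tau> + B * \<tau>\<^sup>2) + \<epsilon> * (norm \<tau>)\<^sup>2 \<le> ln (\<delta> y)" by simp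
    then have "exp (ln (\<delta> x) - Re (A * \<tau> + B * \<tau>\<^sup>2) + \<epsilon> * (norm \<tau>)\<^sup>2) \<le> \<delta> y"
      using pos[OF yD] by (subst (asm) ln_ge_iff) auto
    then have "\<delta> x * norm (E \<tau>) * exp (\<epsilon> * (norm \<tau>)\<^sup>2) \<le> \<delta> y"
    proof -
      have "norm (E \<tau>) = exp (- Re (A * \<tau> + B * \<tau>\<^sup>2))"
        by (simp only: E_def norm_exp_eq_Re uminus_complex.sel)
      then show ?thesis
        using \<open>exp _ \<le> \<delta> y\<close> pos[OF xD] by (simp only: exp_add exp_diff exp_minus exp_ln divide_inverse)
    qed
    moreover have "\<delta> x * norm (E \<tau>) * exp (\<epsilon> * (norm \<tau>)\<^sup>2) \<ge> \<delta> x * norm (E \<tau>) * (1 + \<epsilon> * (norm \<tau>)\<^sup>2)"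
      using pos[OF xD] by (intro mult_left_mono exp_ge_add_one_self) auto
    moreover have "\<delta> x * norm (E \<tau>) * (\<epsilon> * (norm \<tau>)\<^sup>2) \<ge> \<delta> x * (1/2) * (\<epsilon> * (norm \<tau>)\<^sup>2)"
      using d2(2)[of \<tau>] t t' pos[OF xD] n by (intro mult_left_mono mult_right_mono) auto
    ultimately have dy: "\<delta> y \<ge> norm a * norm (E \<tau>) + 2 * c * (norm \<tau>)\<^sup>2"
      using na by (simp add: c_def algebra_simps)
    define m where "m = b + \<tau> *s (w - A *s a) + \<tau>\<^sup>2 *s ((A\<^sup>2 / 2 - B) *s a)"
    have "m = y + (1 - A * \<tau> + (A\<^sup>2 / 2 - B) * \<tau>\<^sup>2) *s a"
      unfolding m_def y_def a_def by (vector algebra_simps)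
    then have "m - (y + E \<tau> *s a) = - ((E \<tau> - (1 - A * \<tau> + (A\<^sup>2 / 2 - B) * \<tau>\<^sup>2)) *s a)"
      by (vector algebra_simps)
    then have "norm (m - (y + E \<tau> *s a)) = norm (E \<tau> - (1 - A * \<tau> + (A\<^sup>2 / 2 - B) * \<tau>\<^sup>2)) * norm a"
      by (simp only: norm_minus_cancel norm_smult_vec)
    also have "\<dots> \<le> (\<epsilon> / 4 * (norm \<tau>)\<^sup>2) * norm a"
      by (intro mult_right_mono d1(2) t') simp
    finally have "norm (m - (y + E \<tau> *s a)) \<le> (\<epsilon> / 4 * (norm \<tau>)\<^sup>2) * norm a" .
    then have "norm (m - (y + E \<tau> *s a)) \<le> c * (norm \<tau>)\<^sup>2" by (simp add: c_def mult_ac)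
    moreover have "norm (m - y) \<le> norm (m - (y + E \<tau> *s a)) + norm (E \<tau> *s a)"
      using norm_triangle_ineq[of "m - (y + E \<tau> *s a)" "E \<tau> *s a"] by simp
    ultimately have "dist y m + c * (norm \<tau>)\<^sup>2 \<le> \<delta> y"
      using dy by (simp add: dist_norm norm_minus_commute norm_smult_vec mult_ac)
    then have "ball m (c * (norm \<tau>)\<^sup>2) \<subseteq> ball y (\<delta> y)"
    proof (intro subsetI)
      fix p assume "p \<in> ball m (c * (norm \<tau>)\<^sup>2)"
      then show "p \<in> ball y (\<delta> y)"
        using \<open>dist y m + c * (norm \<tau>)\<^sup>2 \<le> \<delta> y\<close> dist_triangle[of y p m] by simp
    qed
    then show ?thesis using ball_infdist_subset[OF D(2), of y] unfolding \<delta>_def m_def by blast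
  qed
  moreover have "\<eta>' > 0" using n d1 d2 by (simp add: \<eta>'_def)
  ultimately have "inner_disc D c b (w - A *s a)" unfolding inner_disc_def by blast
  then show thesis using that bf c by blast
qed

lemma integral_inner_cis_smult:
  "((\<lambda>t. inner z (cis t *s (w :: complex ^ 'n))) has_integral 0) {0..2 * pi}"
proof -
  have "inner z (cis t *s w) = Re (poly [:0, Complex (inner z w) (- inner z (\<i> *s w)):] (cis t))" for t
  proof -
    have "cis t *s w = cos t *\<^sub>R w + sin t *\<^sub>R (\<i> *s w)"
      by (vector cis_conv_exp scaleR_conv_of_real exp_Euler cos_of_real sin_of_real algebra_simps)
    then show ?thesis by (simp add: inner_add_right)
  qed
  then show ?thesis
    using has_integral_Re_poly_circle[of "[:0, Complex (inner z w) (- inner z (\<i> *s w)):]"] by simp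
qed

text \<open>In the exhaustion function \<open>u\<close>, the logarithm of the boundary distance
  satisfies the sub-mean value inequality because a failure would give an inner disc, and the square
  of the norm bounds the sublevel sets. A maximum inherits the inequality from its two
  members.\<close>

lemma pseudoconvexI_no_inner_disc:
  fixes D :: "(complex ^ 'n) set"
  assumes D: "open D" and no: "\<And>b c v. b \<in> frontier D \<Longrightarrow> c > 0 \<Longrightarrow> \<not> inner_disc D c b v"
  shows "pseudoconvex D"
proof -
  \<comment> \<open>\<open>infdist\<close> to the empty set is 0 by convention, so the whole space
    is treated apart.\<close>
  define f where "f = (\<lambda>x :: complex ^ 'n. if D = UNIV then 0 else - ln (infdist x (- D)))"
  define u where "u = (\<lambda>x. max (f x) ((norm x)\<^sup>2))"
  have contf: "continuous_on D f"
  proof (cases "D = UNIV")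
    case False
    have "continuous_on D (\<lambda>x. - ln (infdist x (- D)))"
      by (intro continuous_intros) (use infdist_Compl_pos[OF D False] in force)
    then show ?thesis using False by (simp add: f_def)
  qed (simp add: f_def)
  have contu: "continuous_on D u"
    unfolding u_def by (intro continuous_intros contf)
  have "u z \<le> 1 / (2 * pi) * integral {0..2 * pi} (\<lambda>t. u (z + cis t *s w))"
    if sub: "\<forall>\<zeta>\<in>cball 0 1. z + \<zeta> *s w \<in> D" for z w
  proof -
    have circ: "continuous_on {0..2 * pi} (\<lambda>t. g (z + cis t *s w))" if "continuous_on D g" for g :: "_ \<Rightarrow> real"
      by (intro continuous_on_compose2[OF that] continuous_intros) (use sub in auto)
    have le: "1 / (2 * pi) * integral {0..2 * pi} (\<lambda>t. g (z + cis t *s w))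
        \<le> 1 / (2 * pi) * integral {0..2 * pi} (\<lambda>t. u (z + cis t *s w))"
      if "continuous_on D g" "\<And>x. g x \<le> u x" for g
      by (intro mult_left_mono integral_le integrable_continuous_interval circ that contu) auto
    have "f z \<le> 1 / (2 * pi) * integral {0..2 * pi} (\<lambda>t. f (z + cis t *s w))"
    proof (cases "D = UNIV")
      case False
      then show ?thesis
        using inner_disc_of_not_psh[OF D False, of z w] sub no unfolding f_def
        by (simp add: linorder_not_less[symmetric]) blast
    qed (simp add: f_def)
    also note le[OF contf]
    finally have 1: "f z \<le> 1 / (2 * pi) * integral {0..2 * pi} (\<lambda>t. u (z + cis t *s w))"
      by (simp add: u_def)
    have "((\<lambda>t. ((norm z)\<^sup>2 + (norm w)\<^sup>2) + 2 * inner z (cis t *s w)) has_integral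
        2 * pi * ((norm z)\<^sup>2 + (norm w)\<^sup>2) + 2 * 0) {0..2 * pi}"
      using has_integral_const_real[of "(norm z)\<^sup>2 + (norm w)\<^sup>2" 0 "2 * pi"]
      by (intro has_integral_add has_integral_mult_right integral_inner_cis_smult) simp
    moreover have "((norm z)\<^sup>2 + (norm w)\<^sup>2) + 2 * inner z (cis t *s w) = (norm (z + cis t *s w))\<^sup>2" for t
      by (simp add: power2_norm_eq_inner inner_add inner_commute)
        (simp add: power2_norm_eq_inner[symmetric] norm_smult_vec)
    ultimately have "integral {0..2 * pi} (\<lambda>t. (norm (z + cis t *s w))\<^sup>2) = 2 * pi * ((norm z)\<^sup>2 + (norm w)\<^sup>2)"
      by (simp add: integral_unique)
    then have "(norm z)\<^sup>2 \<le> 1 / (2 * pi) * integral {0..2 * pi} (\<lambda>t. (norm (z + cis t *s w))\<^sup>2)"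
      by simp
    also have "\<dots> \<le> 1 / (2 * pi) * integral {0..2 * pi} (\<lambda>t. u (z + cis t *s w))"
      by (rule le) (auto intro!: continuous_intros simp: u_def)
    finally show ?thesis using 1 by (simp add: u_def)
  qed
  then have psh: "continuous_psh_on D u" using contu unfolding continuous_psh_on_def by blast
  have "compact {z \<in> D. u z \<le> c}" for c
  proof -
    have "{z \<in> D. u z \<le> c} = (if D = UNIV then {z. 0 \<le> c} else {z. exp (- c) \<le> infdist z (- D)}) \<inter> {z. (norm z)\<^sup>2 \<le> c}"
    proof (cases "D = UNIV")
      case False
      have "z \<in> D \<and> - ln (infdist z (- D)) \<le> c \<longleftrightarrow> exp (- c) \<le> infdist z (- D)" for z
      proof (cases "z \<in> D")
        case True
        have "- ln (infdist z (- D)) \<le> c \<longleftrightarrow> - c \<le> ln (infdist z (- D))" by auto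
        then show ?thesis
          using True infdist_Compl_pos[OF D False True] by (simp add: ln_ge_iff)
      qed (simp add: not_le)
      then show ?thesis using False by (auto simp: u_def f_def)
    next
      case True
      have "0 \<le> c" if "(norm x)\<^sup>2 \<le> c" for x :: "complex ^ 'n"
        using that by (rule order_trans[OF zero_le_power2])
      with True show ?thesis by (auto simp: u_def f_def)
    qed
    moreover have "closed (if D = UNIV then {z. 0 \<le> c} else {z. exp (- c) \<le> infdist z (- D)})"
      by (auto intro!: closed_Collect_le continuous_intros)
    moreover have "{z :: complex ^ 'n. (norm z)\<^sup>2 \<le> c} = cball 0 (sqrt c)"
      using sqrt_ge_absD[of "norm _" c] by (auto intro: real_le_rsqrt)
    ultimately show ?thesis by (simp add: closed_Int_compact)
  qed
  with D psh show ?thesis unfolding pseudoconvex_def by blast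
qed

section \<open>The Levi form\<close>

definition gradient :: "((complex ^ 'n) \<Rightarrow>\<^sub>L real) \<Rightarrow> complex ^ 'n" where
  "gradient d = (\<Sum>i\<in>Basis. d i *\<^sub>R i)"

lemma blinfun_eq_inner_gradient: "blinfun_apply d h = inner h (gradient d)"
proof -
  have "d h = d (\<Sum>i\<in>Basis. inner h i *\<^sub>R i)" by (simp add: euclidean_representation)
  also have "\<dots> = inner h (gradient d)"
    by (simp add: gradient_def blinfun.sum_right blinfun.scaleR_right inner_sum_right mult.commute)
  finally show ?thesis .
qed

lemma norm_gradient: "norm (gradient d) = norm d"
proof (rule antisym)
  have "norm (gradient d) * norm (gradient d) \<le> norm d * norm (gradient d)"
    using norm_blinfun[of d "gradient d"]
    by (simp add: blinfun_eq_inner_gradient dot_square_norm power2_eq_square)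
  then show "norm (gradient d) \<le> norm d"
    by (cases "norm (gradient d) = 0") (auto simp: mult_le_cancel_right)
  show "norm d \<le> norm (gradient d)"
    by (rule norm_blinfun_bound)
      (auto simp: blinfun_eq_inner_gradient Cauchy_Schwarz_ineq2 mult.commute)
qed

lemma smult_eq_Re_Im: "\<tau> *s (w :: complex ^ 'n) = Re \<tau> *\<^sub>R w + Im \<tau> *\<^sub>R (\<i> *s w)"
proof -
  have "\<tau> *s w = (of_real (Re \<tau>) + \<i> * of_real (Im \<tau>)) *s w"
    by (metis complex_eq)
  also have "\<dots> = of_real (Re \<tau>) *s w + of_real (Im \<tau>) *s (\<i> *s w)"
    by (simp add: vector_sadd_rdistrib vector_smult_assoc mult.commute)
  finally show ?thesis by (simp only: smult_of_real)
qed

lemma blinfun_smult_gradient: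
  "blinfun_apply d (\<zeta> *s gradient d) = Re \<zeta> * (norm d)\<^sup>2"
proof -
  show ?thesis
    by (simp add: blinfun_eq_inner_gradient smult_eq_Re_Im[of \<zeta>] inner_add_left
        dot_square_norm norm_gradient inner_ii_smult_self)
qed

text \<open>The complex-linear functional with real part \<open>d\<close>; for \<open>d\<close> the differential of a defining
  function, its kernel is the complex tangent space.\<close>

definition cpart :: "((complex ^ 'n) \<Rightarrow>\<^sub>L real) \<Rightarrow> complex ^ 'n \<Rightarrow> complex" where
  "cpart d v = Complex (d v) (- d (\<i> *s v))"

lemma Re_cpart: "Re (cpart d v) = d v"
  by (simp add: cpart_def)

lemma cpart_smult: "cpart d (\<zeta> *s v) = \<zeta> * cpart d v"
proof -
  have "\<i> *s (\<zeta> *s v) = (\<i> * \<zeta>) *s v" by (simp add: vector_smult_assoc)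
  then show ?thesis
    by (simp add: cpart_def smult_eq_Re_Im[of "\<zeta>" v] smult_eq_Re_Im[of "\<i> * \<zeta>" v] complex_eq_iff
        blinfun.add_right blinfun.diff_right blinfun.scaleR_right)
qed

lemma cpart_eq_0_iff: "cpart d v = 0 \<longleftrightarrow> d v = 0 \<and> d (\<i> *s v) = 0"
  by (simp add: cpart_def complex_eq_iff)

lemma cpart_diff: "cpart d (v - w) = cpart d v - cpart d w"
proof -
  have "\<i> *s (v - w) = \<i> *s v - \<i> *s w" by (vector algebra_simps)
  then show ?thesis by (simp add: cpart_def blinfun.diff_right complex_eq_iff)
qed

text \<open>One boundary chart with the derivatives of its defining function named, so that the Levi
  form refers to a fixed \<open>r\<close>.\<close>

locale C2_boundary =
  fixes D U :: "(complex ^ 'n) set" and r :: "complex ^ 'n \<Rightarrow> real"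
    and r' :: "complex ^ 'n \<Rightarrow> (complex ^ 'n) \<Rightarrow>\<^sub>L real"
    and r'' :: "complex ^ 'n \<Rightarrow> (complex ^ 'n) \<Rightarrow>\<^sub>L ((complex ^ 'n) \<Rightarrow>\<^sub>L real)"
  assumes open_U: "open U"
    and r': "x \<in> U \<Longrightarrow> (r has_derivative blinfun_apply (r' x)) (at x)"
    and r'': "x \<in> U \<Longrightarrow> (r' has_derivative blinfun_apply (r'' x)) (at x)"
    and cont_r'': "continuous_on U r''"
    and inside: "x \<in> U \<Longrightarrow> x \<in> D \<longleftrightarrow> r x < 0"
    and frontier: "x \<in> U \<Longrightarrow> x \<in> frontier D \<longleftrightarrow> r x = 0"
    and nonzero: "x \<in> U \<Longrightarrow> r x = 0 \<Longrightarrow> r' x \<noteq> 0"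
begin

text \<open>The Laplacian at 0 of \<open>r (x + \<tau> *s w)\<close> as a function of \<tau>, that
  is, four times the usual Levi form; hence \<open>Levi x w / 4\<close> in the expansions.\<close>

definition Levi :: "complex ^ 'n \<Rightarrow> complex ^ 'n \<Rightarrow> real" where
  "Levi x w = r'' x w w + r'' x (\<i> *s w) (\<i> *s w)"

section \<open>Second-order Taylor expansion of the defining function\<close>

lemma second_order_bound:
  assumes x: "x \<in> U" and e: "e > 0"
  obtains \<delta> where "\<delta> > 0" "ball x \<delta> \<subseteq> U"
    "\<And>h. norm h < \<delta> \<Longrightarrow> \<bar>r (x + h) - r x - r' x h - r'' x h h / 2\<bar> \<le> e * (norm h)\<^sup>2"
proof -
  obtain d1 where d1: "d1 > 0" "ball x d1 \<subseteq> U"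
    using open_U x open_contains_ball by blast
  obtain d2 where d2: "d2 > 0" "\<And>y. norm (y - x) < d2 \<Longrightarrow> norm (r' y - r' x - r'' x (y - x)) \<le> e * norm (y - x)"
    using r''[OF x] e unfolding has_derivative_at_alt by blast
  define \<delta> where "\<delta> = min d1 d2"
  have "\<bar>r (x + h) - r x - r' x h - r'' x h h / 2\<bar> \<le> e * (norm h)\<^sup>2" if h: "norm h < \<delta>" for h
  proof -
    \<comment> \<open>With the quadratic Taylor polynomial removed along the segment, the derivative
      of \<open>f\<close> is the error of the linear approximation of \<open>r'\<close> at
      \<open>x\<close>, applied to \<open>h\<close>; the mean value theorem turns this into the
      bound.\<close>
    define f where "f = (\<lambda>s :: real. r (x + s *\<^sub>R h) - s * r' x h - s\<^sup>2 * (r'' x h h / 2))"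
    have U: "x + s *\<^sub>R h \<in> U" if "0 \<le> s" "s \<le> 1" for s
    proof -
      have "norm (s *\<^sub>R h) < d1"
        using that h by (simp add: \<delta>_def) (metis mult_left_le_one_le norm_ge_zero order_le_less_trans)
      then show ?thesis using d1 by (auto simp: dist_norm)
    qed
    have der: "(f has_real_derivative (r' (x + s *\<^sub>R h) h - r' x h - s * r'' x h h)) (at s within {0..1})"
      if "0 \<le> s" "s \<le> 1" for s
    proof -
      have "((\<lambda>s. x + s *\<^sub>R h) has_derivative (\<lambda>t. t *\<^sub>R h)) (at s within {0..1})"
        by (auto intro!: derivative_eq_intros)
      from has_derivative_compose[OF this r'[OF U[OF that]]]
      have "((\<lambda>s. r (x + s *\<^sub>R h)) has_real_derivative r' (x + s *\<^sub>R h) h) (at s within {0..1})"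
        by (simp add: has_field_derivative_def blinfun.scaleR_right mult.commute[of _ "blinfun_apply _ _"])
      then show ?thesis unfolding f_def
        by (auto intro!: derivative_eq_intros)
    qed
    have "\<exists>s\<in>{0<..<1}. f 1 - f 0 = (r' (x + s *\<^sub>R h) h - r' x h - s * r'' x h h) * (1 - 0)"
      by (rule mvt_simple) (auto intro!: der simp flip: has_field_derivative_def)
    then obtain s where s: "0 < s" "s < 1" "f 1 - f 0 = r' (x + s *\<^sub>R h) h - r' x h - s * r'' x h h"
      by auto
    have sh: "norm (s *\<^sub>R h) \<le> norm h" using s by (simp add: mult_left_le_one_le)
    have "norm (r' (x + s *\<^sub>R h) - r' x - r'' x (s *\<^sub>R h)) \<le> e * norm h"
      using d2(2)[of "x + s *\<^sub>R h"] sh h e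
      by (simp add: \<delta>_def) (meson mult_left_mono order_trans less_imp_le)
    then have "\<bar>(r' (x + s *\<^sub>R h) - r' x - r'' x (s *\<^sub>R h)) h\<bar> \<le> e * norm h * norm h"
      using norm_blinfun[of "r' (x + s *\<^sub>R h) - r' x - r'' x (s *\<^sub>R h)" h]
      by (smt (verit, best) mult_right_mono norm_ge_zero real_norm_def)
    moreover have "f 1 - f 0 = (r' (x + s *\<^sub>R h) - r' x - r'' x (s *\<^sub>R h)) h"
      unfolding s(3) by (simp add: blinfun.diff_left blinfun.scaleR_right blinfun.scaleR_left)
    ultimately show ?thesis by (simp add: f_def power2_eq_square)
  qed
  then show thesis using that[of \<delta>] d1 d2(1) by (force simp: \<delta>_def)
qed

text \<open>Along a parabola the coefficient \<open>p\<close> of \<open>s\<^sup>2\<close> enters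
  through the first derivative at the same order as the Hessian of \<open>v\<close>.\<close>

lemma second_order_limit:
  assumes x: "x \<in> U" "r x = 0"
  shows "((\<lambda>s. (r (x + s *\<^sub>R v + s\<^sup>2 *\<^sub>R p) - s * r' x v) / s\<^sup>2) \<longlongrightarrow> r' x p + r'' x v v / 2) (at_right 0)"
proof -
  \<comment> \<open>Division by zero makes \<open>R 0 = 0\<close>, so \<open>R\<close> is continuous
    at 0 and can be composed with a curve that may itself pass through 0.\<close>
  define R where "R = (\<lambda>h. (r (x + h) - r' x h - r'' x h h / 2) / (norm h)\<^sup>2)"
  have "(R \<longlongrightarrow> R 0) (at 0)"
  proof (rule tendstoI)
    fix e :: real assume "e > 0"
    then have "e / 2 > 0" by simp
    then obtain \<delta> where \<delta>: "\<delta> > 0" "ball x \<delta> \<subseteq> U"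
      "\<And>h. norm h < \<delta> \<Longrightarrow> \<bar>r (x + h) - r x - r' x h - r'' x h h / 2\<bar> \<le> e / 2 * (norm h)\<^sup>2"
      by (rule second_order_bound[OF x(1)]) (rule that; assumption)
    have "dist (R h) (R 0) < e" if "norm h < \<delta>" "h \<noteq> 0" for h
    proof -
      have "\<bar>r (x + h) - r' x h - r'' x h h / 2\<bar> \<le> e / 2 * (norm h)\<^sup>2"
        using \<delta>(3)[OF that(1)] x by simp
      also have "\<dots> < e * (norm h)\<^sup>2" using that \<open>e > 0\<close> by simp
      finally show ?thesis using that by (simp add: R_def dist_norm pos_divide_less_eq)
    qed
    then show "\<forall>\<^sub>F h in at 0. dist (R h) (R 0) < e"
      using \<delta>(1) by (auto simp: eventually_at dist_norm)
  qed
  then have R: "isCont R 0" by (simp add: isCont_def)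
  have "((\<lambda>s :: real. s *\<^sub>R v + s\<^sup>2 *\<^sub>R p) \<longlongrightarrow> 0) (at_right 0)"
    by (auto intro!: tendsto_eq_intros)
  from isCont_tendsto_compose[OF R this]
  have "((\<lambda>s. R (s *\<^sub>R v + s\<^sup>2 *\<^sub>R p)) \<longlongrightarrow> 0) (at_right 0)" by (simp add: R_def)
  then have "((\<lambda>s. R (s *\<^sub>R v + s\<^sup>2 *\<^sub>R p) * (norm (v + s *\<^sub>R p))\<^sup>2 + r' x p + r'' x (v + s *\<^sub>R p) (v + s *\<^sub>R p) / 2)
     \<longlongrightarrow> 0 * (norm (v + 0 *\<^sub>R p))\<^sup>2 + r' x p + r'' x (v + 0 *\<^sub>R p) (v + 0 *\<^sub>R p) / 2) (at_right 0)"
    by (intro tendsto_intros) auto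
  moreover have "R (s *\<^sub>R v + s\<^sup>2 *\<^sub>R p) * (norm (v + s *\<^sub>R p))\<^sup>2 + r' x p + r'' x (v + s *\<^sub>R p) (v + s *\<^sub>R p) / 2
      = (r (x + s *\<^sub>R v + s\<^sup>2 *\<^sub>R p) - s * r' x v) / s\<^sup>2" if "s > 0" for s
  proof -
    define k where "k = v + s *\<^sub>R p"
    have k: "s *\<^sub>R v + s\<^sup>2 *\<^sub>R p = s *\<^sub>R k" by (simp add: k_def scaleR_add_right power2_eq_square)
    have "s\<^sup>2 * (R (s *\<^sub>R k) * (norm k)\<^sup>2 + r' x p + r'' x k k / 2) = r (x + s *\<^sub>R k) - s * r' x v"
    proof -
      have "s\<^sup>2 * (R (s *\<^sub>R k) * (norm k)\<^sup>2) = r (x + s *\<^sub>R k) - r' x (s *\<^sub>R k) - s\<^sup>2 * (r'' x k k / 2)"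
        using that x by (cases "k = 0") (simp_all add: R_def power_mult_distrib blinfun.scaleR_right blinfun.scaleR_left power2_eq_square)
      moreover have "r' x (s *\<^sub>R k) = s * r' x v + s\<^sup>2 * r' x p"
        by (simp add: k_def blinfun.add_right blinfun.scaleR_right power2_eq_square algebra_simps)
      ultimately show ?thesis by (simp add: algebra_simps)
    qed
    then have "R (s *\<^sub>R k) * (norm k)\<^sup>2 + r' x p + r'' x k k / 2 = (r (x + s *\<^sub>R k) - s * r' x v) / s\<^sup>2"
      using that by (simp add: field_simps)
    then show ?thesis unfolding k[symmetric] by (simp add: k_def add.assoc)
  qed
  then have "\<forall>\<^sub>F s in at_right 0. R (s *\<^sub>R v + s\<^sup>2 *\<^sub>R p) * (norm (v + s *\<^sub>R p))\<^sup>2 + r' x p + r'' x (v + s *\<^sub>R p) (v + s *\<^sub>R p) / 2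
      = (r (x + s *\<^sub>R v + s\<^sup>2 *\<^sub>R p) - s * r' x v) / s\<^sup>2"
    by (auto simp: eventually_at_right_less intro: eventually_mono[OF eventually_at_right_less])
  ultimately show ?thesis by (simp add: tendsto_cong)
qed

lemma first_order_nonpos:
  assumes x: "x \<in> U" "r x = 0" and neg: "\<forall>\<^sub>F s in at_right 0. r (x + s *\<^sub>R v + s\<^sup>2 *\<^sub>R p) < 0"
  shows "r' x v \<le> 0"
proof -
  have "((\<lambda>s. s * ((r (x + s *\<^sub>R v + s\<^sup>2 *\<^sub>R p) - s * r' x v) / s\<^sup>2) + r' x v) \<longlongrightarrow> 0 * (r' x p + r'' x v v / 2) + r' x v) (at_right 0)"
    by (intro tendsto_intros second_order_limit x)
  moreover have "\<forall>\<^sub>F s in at_right 0. s * ((r (x + s *\<^sub>R v + s\<^sup>2 *\<^sub>R p) - s * r' x v) / s\<^sup>2) + r' x v \<le> 0"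
    using neg eventually_at_right_less[of "0::real"]
    by eventually_elim (simp add: power2_eq_square field_simps)
  ultimately show ?thesis
    using tendsto_upperbound[of _ _ "at_right (0::real)" 0] by fastforce
qed

lemma second_order_nonpos:
  assumes x: "x \<in> U" "r x = 0" and neg: "\<forall>\<^sub>F s in at_right 0. r (x + s *\<^sub>R v + s\<^sup>2 *\<^sub>R p) < 0" and v: "r' x v = 0"
  shows "r' x p + r'' x v v / 2 \<le> 0"
proof -
  have "\<forall>\<^sub>F s in at_right 0. (r (x + s *\<^sub>R v + s\<^sup>2 *\<^sub>R p) - s * r' x v) / s\<^sup>2 \<le> 0"
    using neg by eventually_elim (simp add: v divide_nonpos_nonneg)
  then show ?thesis
    using tendsto_upperbound[OF second_order_limit[OF x]] by simp
qed

section \<open>Inner discs and the sign of the Levi form\<close>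

text \<open>Test the disc on rays with directions 1, -1, i, -i. Opposite rays force the first
  derivative to vanish. At second order the point is moved by \<open>c' * s\<^sup>2\<close> along
  the unit gradient \<nu>, still inside the ball; adding the inequalities for 1 and i cancels the
  unknown \<open>q\<close>, whose factor \<omega>^2 changes sign, and leaves
  \<open>2 * c' * norm (r' x) + Levi x v / 2 \<le> 0\<close>.\<close>

lemma inner_disc_imp_Levi:
  assumes x: "x \<in> U" "r x = 0" and c: "c > 0" and disc: "inner_disc D c x v"
  shows "cpart (r' x) v = 0" "Levi x v \<le> - 4 * c * norm (r' x)"
proof -
  define \<nu> where "\<nu> = gradient (r' x) /\<^sub>R norm (r' x)"
  have nz: "norm (r' x) > 0" using nonzero x by simp
  have \<nu>: "norm \<nu> = 1" "r' x \<nu> = norm (r' x)"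
    using nz by (simp_all add: \<nu>_def norm_gradient blinfun_eq_inner_gradient dot_square_norm power2_eq_square)
  obtain q \<eta> where \<eta>: "\<eta> > 0"
    and disc: "\<And>\<tau>. \<tau> \<noteq> 0 \<Longrightarrow> norm \<tau> < \<eta> \<Longrightarrow> ball (x + \<tau> *s v + \<tau>\<^sup>2 *s q) (c * (norm \<tau>)\<^sup>2) \<subseteq> D"
    using disc unfolding inner_disc_def by blast
  have neg: "\<forall>\<^sub>F s in at_right 0. r (x + s *\<^sub>R (\<omega> *s v) + s\<^sup>2 *\<^sub>R (\<omega>\<^sup>2 *s q + c' *\<^sub>R \<nu>)) < 0"
    if \<omega>: "norm \<omega> = 1" and c': "0 \<le> c'" "c' < c" for \<omega> c'
  proof -
    have "((\<lambda>s. x + s *\<^sub>R (\<omega> *s v) + s\<^sup>2 *\<^sub>R (\<omega>\<^sup>2 *s q + c' *\<^sub>R \<nu>)) \<longlongrightarrow> x) (at_right 0)"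
      by (auto intro!: tendsto_eq_intros)
    then have "\<forall>\<^sub>F s in at_right 0. x + s *\<^sub>R (\<omega> *s v) + s\<^sup>2 *\<^sub>R (\<omega>\<^sup>2 *s q + c' *\<^sub>R \<nu>) \<in> U"
      using open_U x(1) topological_tendstoD by blast
    moreover have "\<forall>\<^sub>F s in at_right 0. s < \<eta>"
      using \<eta> by (simp add: eventually_at_right_field) (metis)
    ultimately show ?thesis using eventually_at_right_less[of "0::real"]
    proof eventually_elim
      fix s :: real
      assume s: "x + s *\<^sub>R (\<omega> *s v) + s\<^sup>2 *\<^sub>R (\<omega>\<^sup>2 *s q + c' *\<^sub>R \<nu>) \<in> U" "s < \<eta>" "0 < s"
      define \<tau> where "\<tau> = of_real s * \<omega>"
      have \<tau>: "norm \<tau> = s" using \<omega> s by (simp add: \<tau>_def norm_mult)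
      define y where "y = x + s *\<^sub>R (\<omega> *s v) + s\<^sup>2 *\<^sub>R (\<omega>\<^sup>2 *s q + c' *\<^sub>R \<nu>)"
      have y: "y = (x + \<tau> *s v + \<tau>\<^sup>2 *s q) + (s\<^sup>2 * c') *\<^sub>R \<nu>"
        unfolding y_def \<tau>_def smult_of_real[symmetric]
        by (vector power2_eq_square algebra_simps)
      have "\<tau> \<noteq> 0" "norm \<tau> < \<eta>" using \<tau> s by auto
      note subsetD[OF disc[OF this]]
      moreover have "y \<in> ball (x + \<tau> *s v + \<tau>\<^sup>2 *s q) (c * (norm \<tau>)\<^sup>2)"
        unfolding y using c' s by (simp add: \<tau> \<nu> dist_norm abs_mult mult.commute)
      ultimately have "y \<in> D" .
      then have "x + s *\<^sub>R (\<omega> *s v) + s\<^sup>2 *\<^sub>R (\<omega>\<^sup>2 *s q + c' *\<^sub>R \<nu>) \<in> D"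
        by (simp only: y_def)
      then show "r (x + s *\<^sub>R (\<omega> *s v) + s\<^sup>2 *\<^sub>R (\<omega>\<^sup>2 *s q + c' *\<^sub>R \<nu>)) < 0"
        using inside s(1) by simp
    qed
  qed
  have first: "r' x (\<omega> *s v) \<le> 0" if "norm \<omega> = 1" for \<omega>
    using first_order_nonpos[OF x neg[OF that, of 0]] c by simp
  have m: "(- \<omega>) *s v = - (\<omega> *s v)" for \<omega> :: complex by (vector)
  have "r' x v = 0"
    using first[of 1] first[of "- 1"] m[of 1] by (simp add: blinfun.minus_right)
  moreover have "r' x (\<i> *s v) = 0"
    using first[of \<i>] first[of "- \<i>"] m[of \<i>] by (simp add: blinfun.minus_right)
  ultimately show cp: "cpart (r' x) v = 0" by (simp add: cpart_eq_0_iff)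
  have "Levi x v \<le> - 4 * c' * norm (r' x)" if c': "0 < c'" "c' < c" for c'
  proof -
    have *: "r' x (\<omega>\<^sup>2 *s q) + c' * norm (r' x) + r'' x (\<omega> *s v) (\<omega> *s v) / 2 \<le> 0"
      if "norm \<omega> = 1" for \<omega>
    proof -
      have "r' x (\<omega> *s v) = 0" using cp Re_cpart[of "r' x" "\<omega> *s v"] by (simp add: cpart_smult)
      from second_order_nonpos[OF x neg[OF that less_imp_le[OF c'(1)] c'(2)] this]
      show ?thesis by (simp add: blinfun.add_right blinfun.scaleR_right \<nu>)
    qed
    have "(- 1) *s q = - q" by (vector)
    then show ?thesis
      using *[of 1] *[of \<i>] *[of "- 1"] *[of "- \<i>"] m[of 1] m[of \<i>]
      by (simp add: Levi_def blinfun.minus_right blinfun.minus_left)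
  qed
  note lim = this
  show "Levi x v \<le> - 4 * c * norm (r' x)"
  proof (rule tendsto_lowerbound)
    show "((\<lambda>c'. - 4 * c' * norm (r' x)) \<longlongrightarrow> - 4 * c * norm (r' x)) (at_left c)"
      by (intro tendsto_intros)
    show "\<forall>\<^sub>F c' in at_left c. Levi x v \<le> - 4 * c' * norm (r' x)"
      unfolding eventually_at_left_field by (intro exI[of _ 0]) (use c lim in auto)
  qed simp
qed

text \<open>The coefficient \<open>q\<close> cancels the pluriharmonic part of the quadratic Taylor polynomial along
  \<open>w\<close>, so that only the Levi form remains.\<close>

lemma Levi_expansion:
  assumes x: "x \<in> U" "r x = 0" and w: "cpart (r' x) w = 0" and n: "\<And>\<zeta>. r' x (\<zeta> *s n) = Re \<zeta>"
  obtains q where "\<And>e. e > 0 \<Longrightarrow> \<exists>\<eta>>0. \<exists>K\<ge>0. \<forall>\<tau> y. norm \<tau> < \<eta> \<and> norm y < \<eta> \<longrightarrow>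
     x + \<tau> *s w + (q * \<tau>\<^sup>2) *s n + y \<in> U \<and>
     r (x + \<tau> *s w + (q * \<tau>\<^sup>2) *s n + y) \<le> r' x y + (Levi x w / 4 + e) * (norm \<tau>)\<^sup>2 + K * (norm y)\<^sup>2"
proof -
  define H where "H = (\<lambda>a b. r'' x a b)"
  define w' where "w' = \<i> *s w"
  \<comment> \<open>Along \<open>\<tau> *s w\<close> half the Hessian is
    \<open>Levi x w / 4 * (norm \<tau>)\<^sup>2\<close> plus the real part of a multiple of
    \<open>\<tau>\<^sup>2\<close>; \<open>q\<close> is minus that multiple.\<close>
  define q where "q = - Complex ((H w w - H w' w') / 4) (- (H w w' + H w' w) / 4)"
  have quad: "H (\<tau> *s w) (\<tau> *s w) / 2 = Levi x w / 4 * (norm \<tau>)\<^sup>2 - Re (q * \<tau>\<^sup>2)" for \<tau>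
  proof -
    have "H (\<tau> *s w) (\<tau> *s w) = (Re \<tau>)\<^sup>2 * H w w + Re \<tau> * Im \<tau> * (H w w' + H w' w) + (Im \<tau>)\<^sup>2 * H w' w'"
      unfolding smult_eq_Re_Im[of \<tau> w] H_def w'_def
      by (simp add: blinfun.add_right blinfun.add_left blinfun.scaleR_right blinfun.scaleR_left power2_eq_square algebra_simps)
    moreover have "Levi x w = H w w + H w' w'" by (simp add: Levi_def H_def w'_def)
    ultimately show ?thesis
      unfolding cmod_power2 by (simp add: q_def power2_eq_square field_simps)
  qed
  define M where "M = norm (r'' x)"
  have M: "\<bar>H a b\<bar> \<le> M * norm a * norm b" for a b
  proof -
    have "\<bar>H a b\<bar> \<le> norm (r'' x a) * norm b" unfolding H_def using norm_blinfun[of "r'' x a" b] by simp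
    also have "\<dots> \<le> (M * norm a) * norm b" unfolding M_def by (intro mult_right_mono norm_blinfun) auto
    finally show ?thesis .
  qed
  have M0: "M \<ge> 0" by (simp add: M_def)
  define W where "W = norm w"
  define Q where "Q = norm q * norm n"
  have WQ: "W \<ge> 0" "Q \<ge> 0" by (simp_all add: W_def Q_def)
  have "\<exists>\<eta>>0. \<exists>K\<ge>0. \<forall>\<tau> y. norm \<tau> < \<eta> \<and> norm y < \<eta> \<longrightarrow>
     x + \<tau> *s w + (q * \<tau>\<^sup>2) *s n + y \<in> U \<and>
     r (x + \<tau> *s w + (q * \<tau>\<^sup>2) *s n + y) \<le> r' x y + (Levi x w / 4 + e) * (norm \<tau>)\<^sup>2 + K * (norm y)\<^sup>2"
    if e: "e > 0" for e
  proof -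
    define e' where "e' = e / (2 * (1 + 2 * W\<^sup>2))"
    have W1: "1 + 2 * W\<^sup>2 > 0" by (simp add: add_pos_nonneg)
    have "e' * (1 + 2 * W\<^sup>2) = e / 2 * ((1 + 2 * W\<^sup>2) / (1 + 2 * W\<^sup>2))"
      unfolding e'_def by (simp only: times_divide_eq_left times_divide_eq_right divide_divide_eq_left)
    then have e': "e' > 0" "e' * (1 + 2 * W\<^sup>2) = e / 2"
      using e W1 by (simp_all add: e'_def)
    obtain \<delta> where \<delta>: "\<delta> > 0" "ball x \<delta> \<subseteq> U"
      "\<And>h. norm h < \<delta> \<Longrightarrow> \<bar>r (x + h) - r x - r' x h - r'' x h h / 2\<bar> \<le> e' * (norm h)\<^sup>2"
      by (rule second_order_bound[OF x(1) e'(1)]) (rule that; assumption)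
    \<comment> \<open>Collects what multiplies the square of \<open>\<kappa> = norm k\<close> below:
      the mixed Hessian terms, the Hessian at \<open>k\<close>, and the Taylor remainder.\<close>
    define C where "C = (M * W)\<^sup>2 / (4 * e') + M / 2 + 2 * e'"
    have C: "C \<ge> 0" using M0 e' by (simp add: C_def)
    \<comment> \<open>The second bound keeps \<open>h\<close> in the ball of the Taylor estimate;
      the third makes the share of \<open>\<kappa>\<^sup>2\<close> caused by \<open>q\<close> cost
      at most half of \<open>e\<close>.\<close>
    define \<eta> where "\<eta> = Min {1, \<delta> / (W + Q + 1), e / (4 * C * Q\<^sup>2 + 1)}"
    have den: "W + Q + 1 > 0" "4 * C * Q\<^sup>2 + 1 > 0" using WQ C by (auto intro: add_nonneg_pos)
    have \<eta>: "\<eta> > 0" using den e \<delta>(1) by (simp add: \<eta>_def)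
    have "x + \<tau> *s w + (q * \<tau>\<^sup>2) *s n + y \<in> U \<and>
       r (x + \<tau> *s w + (q * \<tau>\<^sup>2) *s n + y) \<le> r' x y + (Levi x w / 4 + e) * (norm \<tau>)\<^sup>2 + 2 * C * (norm y)\<^sup>2"
      if ty: "norm \<tau> < \<eta>" "norm y < \<eta>" for \<tau> y
    proof -
      define k where "k = (q * \<tau>\<^sup>2) *s n + y"
      define h where "h = \<tau> *s w + k"
      define t where "t = norm \<tau>"
      define \<kappa> where "\<kappa> = norm k"
      have t: "0 \<le> t" "t \<le> 1" using ty by (auto simp: t_def \<eta>_def)
      have tt: "t\<^sup>2 \<le> t" using t by (simp add: power2_eq_square mult_left_le)
      have \<kappa>: "0 \<le> \<kappa>" "\<kappa> \<le> Q * t\<^sup>2 + norm y"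
        using norm_triangle_ineq[of "(q * \<tau>\<^sup>2) *s n" y]
        by (simp_all add: \<kappa>_def k_def norm_smult_vec Q_def t_def norm_mult norm_power mult_ac)
      have nh: "norm h \<le> W * t + \<kappa>"
        using norm_triangle_ineq[of "\<tau> *s w" k] by (simp add: h_def norm_smult_vec W_def t_def \<kappa>_def mult.commute)
      also have "\<dots> \<le> W * t + (Q * t + norm y)"
        using \<kappa>(2) tt WQ by (smt (verit) mult_left_mono)
      also have "\<dots> < (W + Q + 1) * \<eta>"
        using ty WQ mult_left_mono[of t \<eta> W] mult_left_mono[of t \<eta> Q] by (simp add: t_def algebra_simps)
      also have "\<dots> \<le> (W + Q + 1) * (\<delta> / (W + Q + 1))"
        using den(1) by (intro mult_left_mono) (auto simp: \<eta>_def)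
      also have "\<dots> = \<delta>" using den(1) by simp
      finally have h\<delta>: "norm h < \<delta>" .
      have "norm h ^ 2 \<le> (W * t + \<kappa>)\<^sup>2" by (intro power_mono nh) simp
      also have "\<dots> \<le> 2 * (W * t)\<^sup>2 + 2 * \<kappa>\<^sup>2"
        using zero_le_power2[of "W * t - \<kappa>"] by (simp add: power2_eq_square algebra_simps)
      finally have nh2: "(norm h)\<^sup>2 \<le> 2 * (W * t)\<^sup>2 + 2 * \<kappa>\<^sup>2" .
      have "H h h = H (\<tau> *s w) (\<tau> *s w) + H (\<tau> *s w) k + H k (\<tau> *s w) + H k k"
        by (simp add: H_def h_def blinfun.add_left blinfun.add_right)
      moreover have "\<bar>H (\<tau> *s w) k\<bar> \<le> M * (W * t) * \<kappa>" "\<bar>H k (\<tau> *s w)\<bar> \<le> M * (W * t) * \<kappa>" "\<bar>H k k\<bar> \<le> M * \<kappa> * \<kappa>"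
        using M[of "\<tau> *s w" k] M[of k "\<tau> *s w"] M[of k k]
        by (simp_all add: norm_smult_vec W_def t_def \<kappa>_def mult_ac)
      ultimately have H: "H h h / 2 \<le> H (\<tau> *s w) (\<tau> *s w) / 2 + M * W * t * \<kappa> + M / 2 * \<kappa>\<^sup>2"
        by (simp add: power2_eq_square)
      \<comment> \<open>The mixed term is only linear in \<kappa>; completing a square trades it for
        a small multiple of \<open>t\<^sup>2\<close> and a large one of
        \<open>\<kappa>\<^sup>2\<close>.\<close>
      have amgm: "M * W * t * \<kappa> \<le> e' * t\<^sup>2 + (M * W)\<^sup>2 / (4 * e') * \<kappa>\<^sup>2"
      proof -
        have "0 \<le> (2 * e' * t - M * W * \<kappa>)\<^sup>2 / (4 * e')" using e' by simp
        also have "\<dots> = e' * t\<^sup>2 + (M * W)\<^sup>2 / (4 * e') * \<kappa>\<^sup>2 - M * W * t * \<kappa>"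
          using e' by (simp add: field_simps power2_eq_square)
        finally show ?thesis by simp
      qed
      have \<kappa>2: "\<kappa>\<^sup>2 \<le> 2 * Q\<^sup>2 * \<eta> * t\<^sup>2 + 2 * (norm y)\<^sup>2"
      proof -
        have "\<kappa>\<^sup>2 \<le> (Q * t\<^sup>2 + norm y)\<^sup>2" by (intro power_mono \<kappa>)
        also have "\<dots> \<le> 2 * (Q * t\<^sup>2)\<^sup>2 + 2 * (norm y)\<^sup>2"
          using zero_le_power2[of "Q * t\<^sup>2 - norm y"] by (simp add: power2_eq_square algebra_simps)
        also have "(Q * t\<^sup>2)\<^sup>2 = Q\<^sup>2 * t\<^sup>2 * t\<^sup>2" by (simp add: power2_eq_square)
        also have "\<dots> \<le> Q\<^sup>2 * \<eta> * t\<^sup>2"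
          using tt ty by (intro mult_left_mono mult_right_mono) (auto simp: t_def)
        finally show ?thesis by simp
      qed
      have "r (x + h) \<le> r' x h + H h h / 2 + e' * (norm h)\<^sup>2"
        using \<delta>(3)[OF h\<delta>] x by (simp add: H_def)
      also have "\<dots> \<le> r' x h + (H (\<tau> *s w) (\<tau> *s w) / 2 + (e' * t\<^sup>2 + (M * W)\<^sup>2 / (4 * e') * \<kappa>\<^sup>2) + M / 2 * \<kappa>\<^sup>2)
          + e' * (2 * (W * t)\<^sup>2 + 2 * \<kappa>\<^sup>2)"
        using H amgm mult_left_mono[OF nh2 less_imp_le[OF e'(1)]] by linarith
      also have "\<dots> = r' x h + H (\<tau> *s w) (\<tau> *s w) / 2 + e' * (1 + 2 * W\<^sup>2) * t\<^sup>2 + C * \<kappa>\<^sup>2"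
        by (simp add: C_def power_mult_distrib algebra_simps)
      also have "r' x h = Re (q * \<tau>\<^sup>2) + r' x y"
      proof -
        have "r' x (\<tau> *s w) = 0" using w Re_cpart[of "r' x" "\<tau> *s w"] by (simp add: cpart_smult)
        then show ?thesis by (simp add: h_def k_def blinfun.add_right n)
      qed
      also have "Re (q * \<tau>\<^sup>2) + r' x y + H (\<tau> *s w) (\<tau> *s w) / 2 + e' * (1 + 2 * W\<^sup>2) * t\<^sup>2 + C * \<kappa>\<^sup>2
          \<le> r' x y + Levi x w / 4 * t\<^sup>2 + e / 2 * t\<^sup>2 + C * (2 * Q\<^sup>2 * \<eta> * t\<^sup>2 + 2 * (norm y)\<^sup>2)"
        unfolding quad e'(2) t_def[symmetric] using mult_left_mono[OF \<kappa>2 C] by simp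
      also have "\<dots> = r' x y + (Levi x w / 4 + e / 2 + 2 * C * Q\<^sup>2 * \<eta>) * t\<^sup>2 + 2 * C * (norm y)\<^sup>2"
        by (simp add: algebra_simps)
      also have "\<dots> \<le> r' x y + (Levi x w / 4 + e) * t\<^sup>2 + 2 * C * (norm y)\<^sup>2"
      proof -
        have "(4 * C * Q\<^sup>2) * \<eta> \<le> (4 * C * Q\<^sup>2 + 1) * (e / (4 * C * Q\<^sup>2 + 1))"
          using C \<eta> by (intro mult_mono) (auto simp: \<eta>_def)
        also have "\<dots> = e" using den(2) by simp
        finally have "2 * C * Q\<^sup>2 * \<eta> \<le> e / 2" by simp
        then have "(Levi x w / 4 + e / 2 + 2 * C * Q\<^sup>2 * \<eta>) * t\<^sup>2 \<le> (Levi x w / 4 + e) * t\<^sup>2"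
          by (intro mult_right_mono) auto
        then show ?thesis by simp
      qed
      finally have "r (x + h) \<le> r' x y + (Levi x w / 4 + e) * t\<^sup>2 + 2 * C * (norm y)\<^sup>2" .
      moreover have "x + h \<in> U" using \<delta>(2) h\<delta> by (auto simp: dist_norm)
      ultimately show ?thesis by (simp add: h_def k_def t_def add.assoc)
    qed
    then show ?thesis using \<eta> C by (intro exI[of _ \<eta>] exI[of _ "2 * C"] conjI) auto
  qed
  then show thesis by (rule that)
qed

text \<open>Converse with a loss in the constant: in a ball of radius
  \<open>k * (norm \<tau>)\<^sup>2\<close> the first-order term raises \<open>r\<close> by at most
  \<open>k * norm (r' x) * (norm \<tau>)\<^sup>2\<close>, while the Levi term lowers it by at least
  the same expression with \<open>c > k\<close> in place of \<open>k\<close>.\<close>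

lemma Levi_imp_inner_disc:
  assumes x: "x \<in> U" "r x = 0" and c: "c > 0" "c' < c"
    and v: "cpart (r' x) v = 0" "Levi x v \<le> - 4 * c * norm (r' x)"
  shows "inner_disc D c' x v"
proof -
  \<comment> \<open>\<open>c'\<close> may be zero or negative; the estimates want a positive
    radius.\<close>
  define k where "k = max c' (c / 2)"
  have k: "0 < k" "k < c" using c by (auto simp: k_def)
  define g where "g = norm (r' x)"
  have g: "g > 0" using nonzero[OF x] by (simp add: g_def)
  define n where "n = inverse (complex_of_real (g\<^sup>2)) *s gradient (r' x)"
  have n: "r' x (\<zeta> *s n) = Re \<zeta>" for \<zeta>
  proof -
    have "\<zeta> *s n = (\<zeta> * inverse (complex_of_real (g\<^sup>2))) *s gradient (r' x)" by (simp add: n_def vector_smult_assoc)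
    moreover have "Re (\<zeta> * inverse (complex_of_real (g\<^sup>2))) = Re \<zeta> / g\<^sup>2"
      by (simp add: divide_inverse[symmetric] flip: of_real_inverse of_real_power)
    ultimately show ?thesis using g by (simp add: blinfun_smult_gradient g_def)
  qed
  \<comment> \<open>Half of the margin pays for the error of the expansion, the other half for
    \<open>K * (norm y)\<^sup>2\<close>.\<close>
  define e where "e = (c - k) * g / 2"
  have e: "e > 0" using k g by (simp add: e_def)
  obtain q where q: "\<And>e. e > 0 \<Longrightarrow> \<exists>\<eta>>0. \<exists>K\<ge>0. \<forall>\<tau> y. norm \<tau> < \<eta> \<and> norm y < \<eta> \<longrightarrow>
     x + \<tau> *s v + (q * \<tau>\<^sup>2) *s n + y \<in> U \<and>
     r (x + \<tau> *s v + (q * \<tau>\<^sup>2) *s n + y) \<le> r' x y + (Levi x v / 4 + e) * (norm \<tau>)\<^sup>2 + K * (norm y)\<^sup>2"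
    by (rule Levi_expansion[OF x v(1) n]) (rule that; assumption)
  obtain \<eta> K where \<eta>: "\<eta> > 0" "K \<ge> 0" and
    exp: "\<And>\<tau> y. norm \<tau> < \<eta> \<and> norm y < \<eta> \<Longrightarrow>
     x + \<tau> *s v + (q * \<tau>\<^sup>2) *s n + y \<in> U \<and>
     r (x + \<tau> *s v + (q * \<tau>\<^sup>2) *s n + y) \<le> r' x y + (Levi x v / 4 + e) * (norm \<tau>)\<^sup>2 + K * (norm y)\<^sup>2"
    using q[OF e] by blast
  define \<rho> where "\<rho> = Min {1, \<eta>, \<eta> / k, e / (K * k\<^sup>2 + 1)}"
  have den: "K * k\<^sup>2 + 1 > 0" using \<eta> by (auto intro: add_nonneg_pos)
  have \<rho>: "\<rho> > 0" using \<eta> k e den by (simp add: \<rho>_def)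
  have "ball (x + \<tau> *s v + \<tau>\<^sup>2 *s (q *s n)) (k * (norm \<tau>)\<^sup>2) \<subseteq> D" if t: "\<tau> \<noteq> 0" "norm \<tau> < \<rho>" for \<tau>
  proof
    fix p assume p: "p \<in> ball (x + \<tau> *s v + \<tau>\<^sup>2 *s (q *s n)) (k * (norm \<tau>)\<^sup>2)"
    define y where "y = p - (x + \<tau> *s v + (q * \<tau>\<^sup>2) *s n)"
    have p_eq: "p = x + \<tau> *s v + (q * \<tau>\<^sup>2) *s n + y" by (simp add: y_def)
    have y: "norm y < k * (norm \<tau>)\<^sup>2"
      using p by (simp add: y_def dist_norm norm_minus_commute vector_smult_assoc mult.commute)
    have t2: "(norm \<tau>)\<^sup>2 \<le> norm \<tau>" using t by (simp add: \<rho>_def power2_eq_square mult_left_le)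
    have "k * (norm \<tau>)\<^sup>2 \<le> k * norm \<tau>" using t2 k by simp
    also have "\<dots> < k * (\<eta> / k)" using t k by (intro mult_strict_left_mono) (auto simp: \<rho>_def)
    finally have "norm y < \<eta>" using y k by simp
    then have E: "p \<in> U" "r p \<le> r' x y + (Levi x v / 4 + e) * (norm \<tau>)\<^sup>2 + K * (norm y)\<^sup>2"
      using exp[of \<tau> y] t p_eq by (auto simp: \<rho>_def)
    have "r' x y \<le> g * norm y" using norm_blinfun[of "r' x" y] by (simp add: g_def)
    also have "\<dots> \<le> g * (k * (norm \<tau>)\<^sup>2)" using g y by simp
    finally have 1: "r' x y \<le> g * k * (norm \<tau>)\<^sup>2" by (simp add: mult.assoc)
    have 2: "(Levi x v / 4 + e) * (norm \<tau>)\<^sup>2 \<le> (- c * g + e) * (norm \<tau>)\<^sup>2"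
      using v(2) by (intro mult_right_mono) (auto simp: g_def)
    have "K * (norm y)\<^sup>2 \<le> K * (k * (norm \<tau>)\<^sup>2)\<^sup>2"
      using y \<eta> by (intro mult_left_mono power_mono) auto
    also have "\<dots> = K * k\<^sup>2 * (norm \<tau>)\<^sup>2 * (norm \<tau>)\<^sup>2" by (simp add: power2_eq_square)
    also have "\<dots> < e * (norm \<tau>)\<^sup>2"
    proof (rule mult_strict_right_mono)
      have "K * k\<^sup>2 * (norm \<tau>)\<^sup>2 \<le> (K * k\<^sup>2 + 1) * norm \<tau>" using t2 \<eta> by (intro mult_mono) auto
      also have "\<dots> < (K * k\<^sup>2 + 1) * (e / (K * k\<^sup>2 + 1))"
        using t den by (intro mult_strict_left_mono) (auto simp: \<rho>_def)
      finally show "K * k\<^sup>2 * (norm \<tau>)\<^sup>2 < e" using den by simp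
    qed (use t in simp)
    finally have "r p < (g * k + (- c * g + e) + e) * (norm \<tau>)\<^sup>2"
      using E(2) 1 2 by (simp add: algebra_simps)
    also have "g * k + (- c * g + e) + e = 0" by (simp add: e_def algebra_simps)
    finally show "p \<in> D" using inside[OF E(1)] by simp
  qed
  then have "inner_disc D k x v" unfolding inner_disc_def using \<rho> by blast
  then show ?thesis by (rule inner_disc_antimono) (simp add: k_def)
qed

end

section \<open>Plane sections through an exceptional point\<close>

text \<open>A form of the continuity principle. The discs with constant negative \<open>t\<close>
  have their rims in a fixed compact part of \<Omega>, while their centres tend to \<open>b\<close>
  as \<open>t\<close> tends to 0, so an exhaustion function contradicts the maximum principle. But
  these discs are quadratic, whereas the inequality for \<open>u\<close> concerns affine discs. The
  contradiction is therefore drawn from an affine disc tangent to a quadratic one, at the maximum of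
  a perturbation of \<open>u\<close> over a family of discs.\<close>

lemma not_pseudoconvex_of_disc_family:
  fixes \<Omega> :: "(complex ^ 'm) set"
  assumes psc: "pseudoconvex \<Omega>" and c: "c > 0" and K: "K \<ge> 0" and \<rho>: "\<rho> > 0"
    and sub: "\<And>\<tau> t. norm \<tau> \<le> \<rho> \<Longrightarrow> norm t \<le> \<rho> \<Longrightarrow> Re t - c * (norm \<tau>)\<^sup>2 + K * (norm t)\<^sup>2 < 0 \<Longrightarrow>
      b + \<tau> *s w + (t + q * \<tau>\<^sup>2) *s n \<in> \<Omega>"
    and out: "b \<notin> \<Omega>"
  shows False
proof -
  define \<Phi> where "\<Phi> = (\<lambda>(\<tau>, t). b + \<tau> *s w + (t + q * \<tau>\<^sup>2) *s n)"
  have cont\<Phi>: "continuous_on X \<Phi>" for X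
    unfolding \<Phi>_def case_prod_unfold by (intro continuous_intros)
  obtain u where psh: "continuous_psh_on \<Omega> u" and cpt: "\<And>c. compact {z \<in> \<Omega>. u z \<le> c}"
    using psc unfolding pseudoconvex_def by blast
  have contu: "continuous_on \<Omega> u" using psh by (simp add: continuous_psh_on_def)
  have contv: "continuous_on X (\<lambda>p. u (\<Phi> p))" if "\<Phi> ` X \<subseteq> \<Omega>" for X
    using continuous_on_compose2[OF contu cont\<Phi> that] .
  \<comment> \<open>So small that \<open>- c * \<rho>\<^sup>2\<close> dominates on the rim for all
    \<open>t\<close> of norm at most \<eta>.\<close>
  define \<eta> where "\<eta> = Min {1, \<rho>, c * \<rho>\<^sup>2 / (2 * (1 + K))}"
  have \<eta>: "0 < \<eta>" "\<eta> \<le> 1" "\<eta> \<le> \<rho>" using c K \<rho> by (auto simp: \<eta>_def)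
  have \<eta>2: "\<eta> + K * \<eta>\<^sup>2 < c * \<rho>\<^sup>2"
  proof -
    have "\<eta>\<^sup>2 \<le> \<eta>" using \<eta> by (simp add: power2_eq_square mult_left_le)
    then have "\<eta> + K * \<eta>\<^sup>2 \<le> (1 + K) * \<eta>" using mult_left_mono[of "\<eta>\<^sup>2" \<eta> K] K by (simp add: algebra_simps)
    also have "\<dots> \<le> (1 + K) * (c * \<rho>\<^sup>2 / (2 * (1 + K)))"
      using K by (intro mult_left_mono) (auto simp: \<eta>_def)
    also have "\<dots> = c * \<rho>\<^sup>2 / 2"
    proof -
      have "k * (y / (2 * k)) = y / 2" if "k > 0" for k y :: real using that by simp
      then show ?thesis using K by (simp only: add_pos_nonneg zero_less_one)
    qed
    also have "\<dots> < c * \<rho>\<^sup>2" using c \<rho> by simp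
    finally show ?thesis .
  qed
  have rim: "\<Phi> ` (sphere 0 \<rho> \<times> cball 0 \<eta>) \<subseteq> \<Omega>"
  proof -
    have "\<Phi> (\<tau>, t) \<in> \<Omega>" if "norm \<tau> = \<rho>" "norm t \<le> \<eta>" for \<tau> t
    proof -
      have "K * (norm t)\<^sup>2 \<le> K * \<eta>\<^sup>2" using that K by (intro mult_left_mono power_mono) auto
      moreover have "Re t \<le> norm t" by (rule complex_Re_le_cmod)
      ultimately have "Re t - c * (norm \<tau>)\<^sup>2 + K * (norm t)\<^sup>2 < 0" using \<eta>2 that by simp
      then show ?thesis using sub[of \<tau> t] that \<eta> by (simp add: \<Phi>_def)
    qed
    then show ?thesis by auto
  qed
  have cptrim: "compact (\<Phi> ` (sphere 0 \<rho> \<times> cball 0 \<eta>))"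
    by (intro compact_continuous_image cont\<Phi> compact_Times compact_sphere compact_cball)
  have "compact (u ` \<Phi> ` (sphere 0 \<rho> \<times> cball 0 \<eta>))"
    by (rule compact_continuous_image[OF continuous_on_subset[OF contu rim] cptrim])
  then obtain M where "\<And>x. x \<in> u ` \<Phi> ` (sphere 0 \<rho> \<times> cball 0 \<eta>) \<Longrightarrow> \<bar>x\<bar> \<le> M"
    by (metis compact_imp_bounded bounded_real)
  then have M: "u (\<Phi> (\<tau>, t)) \<le> M" if "norm \<tau> = \<rho>" "norm t \<le> \<eta>" for \<tau> t
    using that by (force dest: abs_le_D1)
  \<comment> \<open>Exceeds \<open>u\<close> on the rim even after
    \<open>(norm \<tau>)\<^sup>2\<close> is added. The sublevel set \<open>S\<close> is compact and
    misses \<open>b\<close>, so the centre of the disc lies outside \<open>S\<close> for small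
    \<sigma>.\<close>
  define M' where "M' = M + \<rho>\<^sup>2 + 1"
  define S where "S = {z \<in> \<Omega>. u z \<le> M'}"
  have "open (- S)" using compact_imp_closed[OF cpt[of M']] by (simp add: S_def open_Compl)
  moreover have "b \<in> - S" using out by (simp add: S_def)
  moreover have "((\<lambda>\<sigma> :: real. \<Phi> (0, - of_real \<sigma>)) \<longlongrightarrow> b) (at_right 0)"
    unfolding \<Phi>_def case_prod_conv smult_of_real of_real_minus[symmetric] by (auto intro!: tendsto_eq_intros simp: smult_of_real simp del: of_real_minus)
  ultimately have "\<forall>\<^sub>F \<sigma> in at_right 0. \<Phi> (0, - of_real \<sigma>) \<in> - S"
    using topological_tendstoD by blast
  \<comment> \<open>The first bound puts the disc |t + \<sigma>| \<le> \<sigma>/2 inside |t| \<le>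
    \<eta>; by the second, K |t|^2 is less than \<sigma>/2 there, while Re t is at most
    -\<sigma>/2.\<close>
  moreover have "\<forall>\<^sub>F \<sigma> in at_right 0. \<sigma> < min (2 / 3 * \<eta>) (1 / (9 * (K + 1)))"
    by (rule order_tendstoD(2)[of "\<lambda>x. x" 0]) (use \<eta> K in auto)
  ultimately have "\<forall>\<^sub>F \<sigma> in at_right 0. \<Phi> (0, - of_real \<sigma>) \<in> - S \<and> \<sigma> < min (2 / 3 * \<eta>) (1 / (9 * (K + 1))) \<and> 0 < \<sigma>"
    using eventually_at_right_less[of "0::real"] by eventually_elim simp
  then obtain \<sigma> where \<sigma>: "\<Phi> (0, - of_real \<sigma>) \<notin> S" "3 / 2 * \<sigma> < \<eta>" "\<sigma> < 1 / (9 * (K + 1))" "0 < \<sigma>"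
    using eventually_happens[of _ "at_right (0::real)"] by force
  have K\<sigma>: "9 * K * \<sigma> < 1"
  proof -
    have "9 * (K + 1) * \<sigma> < 1" using \<sigma>(3) K by (simp add: field_simps)
    then show ?thesis using \<sigma>(4) by (simp add: algebra_simps)
  qed
  define E where "E = cball (0 :: complex) \<rho> \<times> cball (- of_real \<sigma> :: complex) (\<sigma> / 2)"
  have E_eq: "(\<tau>, t) \<in> E \<longleftrightarrow> norm \<tau> \<le> \<rho> \<and> norm (t + of_real \<sigma>) \<le> \<sigma> / 2" for \<tau> t
  proof -
    have "dist (- of_real \<sigma>) t = norm (t + of_real \<sigma>)"
      by (metis add.commute diff_minus_eq_add dist_commute dist_norm)
    then show ?thesis by (simp add: E_def)
  qed
  have near: "norm t \<le> 3 / 2 * \<sigma>" "Re t \<le> - \<sigma> / 2" if "norm (t + of_real \<sigma>) \<le> \<sigma> / 2" for t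
  proof -
    show "norm t \<le> 3 / 2 * \<sigma>"
      using norm_triangle_ineq4[of "t + of_real \<sigma>" "of_real \<sigma>"] that \<sigma>(4) by simp
    show "Re t \<le> - \<sigma> / 2"
      using complex_Re_le_cmod[of "t + of_real \<sigma>"] that by simp
  qed
  have E_sub: "\<Phi> ` E \<subseteq> \<Omega>"
  proof -
    have "\<Phi> (\<tau>, t) \<in> \<Omega>" if "(\<tau>, t) \<in> E" for \<tau> t
    proof -
      have t: "norm t \<le> 3 / 2 * \<sigma>" "Re t \<le> - \<sigma> / 2" and \<tau>: "norm \<tau> \<le> \<rho>" using that near E_eq by auto
      have "K * (norm t)\<^sup>2 \<le> K * (3 / 2 * \<sigma>)\<^sup>2" using K t(1) by (intro mult_left_mono power_mono) auto
      also have "\<dots> = \<sigma> * (9 * K * \<sigma>) / 4" by (simp add: power2_eq_square)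
      also have "\<dots> < \<sigma> * 1 / 2" using mult_strict_left_mono[OF K\<sigma> \<sigma>(4)] \<sigma>(4) by simp
      finally have "Re t - c * (norm \<tau>)\<^sup>2 + K * (norm t)\<^sup>2 < 0"
        using t(2) mult_nonneg_nonneg[OF less_imp_le[OF c] zero_le_power2[of "norm \<tau>"]] by linarith
      then show ?thesis using sub[OF \<tau>, of t] t(1) \<sigma>(2) \<eta>(3) by (simp add: \<Phi>_def)
    qed
    then show ?thesis by auto
  qed
  have cE: "compact E" by (simp add: E_def compact_Times)
  obtain N where N: "\<And>p. p \<in> E \<Longrightarrow> u (\<Phi> p) \<le> N"
  proof -
    have "compact ((\<lambda>p. u (\<Phi> p)) ` E)" by (intro compact_continuous_image contv E_sub cE)
    then obtain N where "\<And>x. x \<in> (\<lambda>p. u (\<Phi> p)) ` E \<Longrightarrow> \<bar>x\<bar> \<le> N" by (metis compact_imp_bounded bounded_real)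
    then show thesis using that[of N] by (force dest: abs_le_D1)
  qed
  \<comment> \<open>A penalty large enough to keep \<open>F\<close> at or below \<open>M'\<close>
    where |t + \<sigma>| = \<sigma>/2; the value of \<open>F\<close> at the centre is
    larger.\<close>
  define K' where "K' = max 0 ((N + \<rho>\<^sup>2 - M') / (\<sigma> / 2)\<^sup>2)"
  have K': "K' \<ge> 0" "K' * (\<sigma> / 2)\<^sup>2 \<ge> N + \<rho>\<^sup>2 - M'"
  proof -
    show "K' \<ge> 0" by (simp add: K'_def)
    have "(N + \<rho>\<^sup>2 - M') / (\<sigma> / 2)\<^sup>2 \<le> K'" by (simp add: K'_def)
    then show "K' * (\<sigma> / 2)\<^sup>2 \<ge> N + \<rho>\<^sup>2 - M'" using \<sigma>(4) by (subst (asm) pos_divide_le_eq) auto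
  qed
  \<comment> \<open>The square of |\<tau>| makes the sub-mean value inequality strict, hence
    contradictory at an interior maximum; the penalty makes the maximum interior in
    \<open>t\<close>.\<close>
  define F where "F = (\<lambda>p. u (\<Phi> p) + (norm (fst p))\<^sup>2 - K' * (norm (snd p + of_real \<sigma>))\<^sup>2)"
  have contF: "continuous_on E F"
    unfolding F_def by (intro continuous_intros contv E_sub)
  have ctr: "(0, - of_real \<sigma>) \<in> E" using \<rho> \<sigma>(4) by (simp add: E_eq)
  then obtain \<tau>\<^sub>0 t\<^sub>0 where max: "(\<tau>\<^sub>0, t\<^sub>0) \<in> E" "\<And>p. p \<in> E \<Longrightarrow> F p \<le> F (\<tau>\<^sub>0, t\<^sub>0)"
    using continuous_attains_sup[OF cE _ contF] by force
  have "\<Phi> (0, - of_real \<sigma>) \<in> \<Omega>" using E_sub ctr by blast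
  then have "u (\<Phi> (0, - of_real \<sigma>)) > M'" using \<sigma>(1) by (simp add: S_def)
  then have big: "F (\<tau>\<^sub>0, t\<^sub>0) > M'" using max(2)[OF ctr] by (simp add: F_def)
  have \<tau>0: "norm \<tau>\<^sub>0 < \<rho>"
  proof (rule ccontr)
    assume "\<not> ?thesis"
    then have "norm \<tau>\<^sub>0 = \<rho>" using max(1) by (simp add: E_eq)
    moreover have "norm t\<^sub>0 \<le> \<eta>" using near(1)[of t\<^sub>0] max(1) \<sigma>(2) by (simp add: E_eq)
    ultimately have "F (\<tau>\<^sub>0, t\<^sub>0) \<le> M + \<rho>\<^sup>2" using M[of \<tau>\<^sub>0 t\<^sub>0] mult_nonneg_nonneg[OF K'(1) zero_le_power2[of "norm (t\<^sub>0 + of_real \<sigma>)"]]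
      by (simp add: F_def)
    then show False using big by (simp add: M'_def)
  qed
  have t0: "norm (t\<^sub>0 + of_real \<sigma>) < \<sigma> / 2"
  proof (rule ccontr)
    assume "\<not> ?thesis"
    then have eq: "norm (t\<^sub>0 + of_real \<sigma>) = \<sigma> / 2" using max(1) by (simp add: E_eq)
    have "F (\<tau>\<^sub>0, t\<^sub>0) \<le> N + \<rho>\<^sup>2 - K' * (\<sigma> / 2)\<^sup>2"
      using N[OF max(1)] power_mono[of "norm \<tau>\<^sub>0" \<rho> 2] \<tau>0 unfolding F_def snd_conv eq by simp
    then show False using big K'(2) by simp
  qed
  have "((\<lambda>l. norm \<tau>\<^sub>0 + l) \<longlongrightarrow> norm \<tau>\<^sub>0) (at_right 0)" by (auto intro!: tendsto_eq_intros)
  then have l1: "\<forall>\<^sub>F l in at_right 0. norm \<tau>\<^sub>0 + l < \<rho>" using \<tau>0 by (rule order_tendstoD)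
  have "((\<lambda>l. norm (t\<^sub>0 + of_real \<sigma>) + norm q * l\<^sup>2) \<longlongrightarrow> norm (t\<^sub>0 + of_real \<sigma>)) (at_right 0)" by (auto intro!: tendsto_eq_intros)
  then have l2: "\<forall>\<^sub>F l in at_right 0. norm (t\<^sub>0 + of_real \<sigma>) + norm q * l\<^sup>2 < \<sigma> / 2" using t0 by (rule order_tendstoD)
  have "((\<lambda>l. K' * (norm q)\<^sup>2 * l\<^sup>2) \<longlongrightarrow> 0) (at_right 0)" by (auto intro!: tendsto_eq_intros)
  then have l3: "\<forall>\<^sub>F l in at_right 0. K' * (norm q)\<^sup>2 * l\<^sup>2 < 1" by (rule order_tendstoD) simp
  have "\<forall>\<^sub>F l in at_right 0. 0 < l \<and> norm \<tau>\<^sub>0 + l < \<rho> \<and> norm (t\<^sub>0 + of_real \<sigma>) + norm q * l\<^sup>2 < \<sigma> / 2 \<and> K' * (norm q)\<^sup>2 * l\<^sup>2 < 1"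
    using l1 l2 l3 eventually_at_right_less[of "0::real"] by eventually_elim simp
  then obtain l :: real where l: "0 < l" "norm \<tau>\<^sub>0 + l < \<rho>" "norm (t\<^sub>0 + of_real \<sigma>) + norm q * l\<^sup>2 < \<sigma> / 2"
      "K' * (norm q)\<^sup>2 * l\<^sup>2 < 1"
    using eventually_happens[of _ "at_right (0::real)"] by force
  define z where "z = \<Phi> (\<tau>\<^sub>0, t\<^sub>0)"
  \<comment> \<open>\<open>l\<close> times the tangent vector at \<open>\<tau>\<^sub>0\<close> of
    the quadratic disc \<open>t = t\<^sub>0\<close>.\<close>
  define w0 where "w0 = of_real l *s (w + (2 * q * \<tau>\<^sub>0) *s n)"
  define T where "T = (\<lambda>\<zeta> :: complex. (\<tau>\<^sub>0 + of_real l * \<zeta>, t\<^sub>0 - q * (of_real l * \<zeta>)\<^sup>2))"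
  \<comment> \<open>an affine disc through the maximum point, bent in the coordinates \<open>(\<tau>, t)\<close>\<close>
  have disc: "z + \<zeta> *s w0 = \<Phi> (T \<zeta>)" for \<zeta>
    unfolding z_def w0_def T_def \<Phi>_def by (vector power2_eq_square algebra_simps)
  have TE: "T \<zeta> \<in> E" if "norm \<zeta> \<le> 1" for \<zeta>
  proof -
    have lz: "norm (of_real l * \<zeta>) \<le> l" using that l(1) by (simp add: norm_mult mult_left_le)
    have "norm (\<tau>\<^sub>0 + of_real l * \<zeta>) \<le> \<rho>"
      using norm_triangle_ineq[of \<tau>\<^sub>0 "of_real l * \<zeta>"] lz l(2) by linarith
    moreover have "norm (t\<^sub>0 - q * (of_real l * \<zeta>)\<^sup>2 + of_real \<sigma>) \<le> \<sigma> / 2"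
    proof -
      have "norm (q * (of_real l * \<zeta>)\<^sup>2) \<le> norm q * l\<^sup>2"
        unfolding norm_mult[of q] norm_power by (intro mult_left_mono power_mono lz) auto
      then have "norm ((t\<^sub>0 + of_real \<sigma>) - q * (of_real l * \<zeta>)\<^sup>2) \<le> \<sigma> / 2"
        using norm_triangle_ineq4[of "t\<^sub>0 + of_real \<sigma>" "q * (of_real l * \<zeta>)\<^sup>2"] l(3) by linarith
      then show ?thesis by (simp only: diff_add_eq)
    qed
    ultimately show ?thesis by (simp add: T_def E_eq)
  qed
  have inside: "\<forall>\<zeta>\<in>cball 0 1. z + \<zeta> *s w0 \<in> \<Omega>" using TE E_sub by (auto simp: disc)
  \<comment> \<open>Its real part gathers the cross terms of the two squared norms in
    \<open>F\<close>; as \<open>p\<close> vanishes at 0, they average to zero over the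
    circle.\<close>
  define p where "p = [:0, - 2 * of_real l * cnj \<tau>\<^sub>0, - 2 * of_real (K' * l\<^sup>2) * cnj (t\<^sub>0 + of_real \<sigma>) * q:]"
  \<comment> \<open>The mean gain \<open>l\<^sup>2\<close> from |\<tau>|^2 less the mean loss from
    the penalty, which is of order \<open>l ^ 4\<close> because the affine disc leaves the quadratic
    one only at second order.\<close>
  define d where "d = l\<^sup>2 * (1 - K' * (norm q)\<^sup>2 * l\<^sup>2)"
  have d: "d > 0" using l by (simp add: d_def)
  have le: "u (z + cis \<theta> *s w0) \<le> u z - d + Re (poly p (cis \<theta>))" for \<theta>
  proof -
    have sq: "(norm (x + y))\<^sup>2 = (norm x)\<^sup>2 + 2 * Re (cnj x * y) + (norm y)\<^sup>2" for x y :: complex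
      unfolding cmod_power2 by (simp add: power2_eq_square algebra_simps)
    define X where "X = of_real l * cis \<theta>"
    define Y where "Y = - (q * X\<^sup>2)"
    have nX: "norm X = l" "norm Y = norm q * l\<^sup>2"
      using l(1) by (simp_all add: X_def Y_def norm_mult norm_power)
    have T: "fst (T (cis \<theta>)) = \<tau>\<^sub>0 + X" "snd (T (cis \<theta>)) + of_real \<sigma> = (t\<^sub>0 + of_real \<sigma>) + Y"
      by (simp_all add: T_def X_def Y_def)
    have "F (T (cis \<theta>)) \<le> F (\<tau>\<^sub>0, t\<^sub>0)" by (intro max TE) simp
    then have "u (z + cis \<theta> *s w0) \<le> u z
        - (2 * Re (cnj \<tau>\<^sub>0 * X) + l\<^sup>2) + K' * (2 * Re (cnj (t\<^sub>0 + of_real \<sigma>) * Y) + (norm q * l\<^sup>2)\<^sup>2)"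
      unfolding F_def disc z_def[symmetric] T sq[of \<tau>\<^sub>0 X] sq[of "t\<^sub>0 + of_real \<sigma>" Y] nX fst_conv snd_conv by (simp only: distrib_left)
    also have "\<dots> = u z - d + Re (poly p (cis \<theta>))"
    proof -
      have "poly p (cis \<theta>) = of_real (- 2) * (cnj \<tau>\<^sub>0 * X) + of_real (K' * 2) * (cnj (t\<^sub>0 + of_real \<sigma>) * Y)"
        by (simp add: p_def X_def Y_def power2_eq_square algebra_simps)
      then have "Re (poly p (cis \<theta>)) = - 2 * Re (cnj \<tau>\<^sub>0 * X) + K' * 2 * Re (cnj (t\<^sub>0 + of_real \<sigma>) * Y)"
        by (simp only: plus_complex.sel Re_complex_of_real Im_complex_of_real times_complex.sel(1)[of "of_real _"] mult_zero_left diff_zero)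
      then show ?thesis by (simp only:) (simp add: d_def power2_eq_square algebra_simps)
    qed
    finally show ?thesis .
  qed
  have "((\<lambda>\<theta>. (u z - d) + Re (poly p (cis \<theta>))) has_integral 2 * pi * (u z - d) + 2 * pi * Re (poly p 0)) {0..2 * pi}"
    using has_integral_const_real[of "u z - d" 0 "2 * pi"]
    by (intro has_integral_add has_integral_Re_poly_circle) simp
  then have int: "((\<lambda>\<theta>. (u z - d) + Re (poly p (cis \<theta>))) has_integral 2 * pi * (u z - d)) {0..2 * pi}"
    by (simp add: p_def)
  have "continuous_on {0..2 * pi} (\<lambda>\<theta>. u (z + cis \<theta> *s w0))"
    by (intro continuous_on_compose2[OF contu] continuous_intros) (use inside in auto)
  then have "integral {0..2 * pi} (\<lambda>\<theta>. u (z + cis \<theta> *s w0)) \<le> 2 * pi * (u z - d)"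
    using int le by (intro has_integral_le[OF integrable_integral int] integrable_continuous_interval) auto
  then have "1 / (2 * pi) * integral {0..2 * pi} (\<lambda>\<theta>. u (z + cis \<theta> *s w0)) \<le> 1 / (2 * pi) * (2 * pi * (u z - d))"
    by (intro mult_left_mono) auto
  moreover have "u z \<le> 1 / (2 * pi) * integral {0..2 * pi} (\<lambda>\<theta>. u (z + cis \<theta> *s w0))"
    using psh inside unfolding continuous_psh_on_def by blast
  ultimately show False using d by simp
qed

context C2_boundary
begin

text \<open>Were \<open>x - a\<close> not complex tangent, a multiple of it could serve as the
  direction \<open>n\<close> of the quadratic expansion. The whole family of discs would then lie in
  the plane through \<open>a\<close> spanned by \<open>x - a\<close> and \<open>w\<close>, and its
  pullback to \<open>complex ^ 2\<close> contradicts pseudoconvexity of the section.\<close>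

lemma exceptional_point_complex_tangent:
  assumes D: "open D" and x: "x \<in> U" "r x = 0" and w: "cpart (r' x) w = 0" "Levi x w < 0"
    and a: "exceptional_point a D"
  shows "cpart (r' x) (x - a) = 0"
proof (rule ccontr)
  assume nt: "cpart (r' x) (x - a) \<noteq> 0"
  define n where "n = inverse (cpart (r' x) (x - a)) *s (x - a)"
  have n: "r' x (\<zeta> *s n) = Re \<zeta>" for \<zeta>
  proof -
    have "cpart (r' x) (\<zeta> *s n) = \<zeta>" unfolding n_def cpart_smult using nt by simp
    then show ?thesis using Re_cpart by metis
  qed
  \<comment> \<open>Chosen so that an expansion error of \<open>c\<close> turns the coefficient
    \<open>Levi x w / 4\<close> into exactly \<open>- c\<close>.\<close>
  define c where "c = - Levi x w / 8"
  have c: "c > 0" "Levi x w / 4 + c = - c" using w by (simp_all add: c_def)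
  obtain q where q: "\<And>e. e > 0 \<Longrightarrow> \<exists>\<eta>>0. \<exists>K\<ge>0. \<forall>\<tau> y. norm \<tau> < \<eta> \<and> norm y < \<eta> \<longrightarrow>
     x + \<tau> *s w + (q * \<tau>\<^sup>2) *s n + y \<in> U \<and>
     r (x + \<tau> *s w + (q * \<tau>\<^sup>2) *s n + y) \<le> r' x y + (Levi x w / 4 + e) * (norm \<tau>)\<^sup>2 + K * (norm y)\<^sup>2"
    by (rule Levi_expansion[OF x w(1) n]) (rule that; assumption)
  obtain \<eta> K where \<eta>: "\<eta> > 0" "K \<ge> 0" and
    exp: "\<And>\<tau> y. norm \<tau> < \<eta> \<and> norm y < \<eta> \<Longrightarrow>
     x + \<tau> *s w + (q * \<tau>\<^sup>2) *s n + y \<in> U \<and>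
     r (x + \<tau> *s w + (q * \<tau>\<^sup>2) *s n + y) \<le> r' x y + - c * (norm \<tau>)\<^sup>2 + K * (norm y)\<^sup>2"
    using q[OF c(1)] unfolding c(2) by blast
  define \<rho> where "\<rho> = min (\<eta> / 2) (\<eta> / (2 * (norm n + 1)))"
  have \<rho>: "\<rho> > 0" using \<eta> by (simp add: \<rho>_def add_nonneg_pos)
  have sub: "x + \<tau> *s w + (t + q * \<tau>\<^sup>2) *s n \<in> D"
    if "norm \<tau> \<le> \<rho>" "norm t \<le> \<rho>" "Re t - c * (norm \<tau>)\<^sup>2 + K * (norm n)\<^sup>2 * (norm t)\<^sup>2 < 0" for \<tau> t
  proof -
    have "norm (t *s n) \<le> \<rho> * (norm n + 1)"
      unfolding norm_smult_vec using that \<rho> by (intro mult_mono) auto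
    also have "\<dots> \<le> \<eta> / (2 * (norm n + 1)) * (norm n + 1)"
      by (intro mult_right_mono) (auto simp: \<rho>_def)
    also have "\<dots> = \<eta> / 2" by (simp add: field_simps add_nonneg_eq_0_iff)
    finally have "norm \<tau> < \<eta> \<and> norm (t *s n) < \<eta>" using that \<eta> by (auto simp: \<rho>_def)
    from exp[OF this] have "x + \<tau> *s w + (q * \<tau>\<^sup>2) *s n + t *s n \<in> U"
      "r (x + \<tau> *s w + (q * \<tau>\<^sup>2) *s n + t *s n) < 0"
      using that(3) by (auto simp: n norm_smult_vec power_mult_distrib algebra_simps)
    then have "x + \<tau> *s w + (q * \<tau>\<^sup>2) *s n + t *s n \<in> D" using inside by blast
    then show ?thesis by (simp add: vector_sadd_rdistrib algebra_simps)
  qed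
  define V where "V = vec.span {x - a, w}"
  define P where "P = (\<lambda>v. a + v) ` V"
  have "w \<noteq> 0" using w(2) by (auto simp: Levi_def)
  moreover have "x - a \<notin> vec.span {w}"
    using nt w(1) by (auto simp: vec.span_singleton cpart_smult)
  ultimately have "vec.independent {x - a, w}" and "x - a \<noteq> w"
    using vec.span_base[of w "{w}"] by (auto simp: vec.independent_insert)
  then have "complex_plane P"
    unfolding complex_plane_def P_def V_def
    by (intro exI[of _ a] exI[of _ "vec.span {x - a, w}"])
       (simp add: vec.dim_eq_card_independent)
  moreover have "a \<in> P" using vec.span_zero by (force simp: P_def V_def)
  moreover have inP: "x + \<alpha> *s w + \<beta> *s n \<in> P" for \<alpha> \<beta>
  proof -
    have "(x - a) + \<alpha> *s w + \<beta> *s n \<in> V"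
      unfolding V_def n_def by (intro vec.span_add vec.span_scale vec.span_base) auto
    then show ?thesis unfolding P_def by (rule rev_image_eqI) simp
  qed
  moreover have "P \<inter> D \<noteq> {}"
  proof -
    have "x + of_real \<rho> *s w + (0 + q * (of_real \<rho>)\<^sup>2) *s n \<in> D"
      by (rule sub) (use \<rho> c in auto)
    then show ?thesis using inP by blast
  qed
  ultimately have "pseudoconvex_in_plane P (P \<inter> D)"
    using a unfolding exceptional_point_def by blast
  then obtain p and L :: "complex ^ 2 \<Rightarrow> complex ^ 'n" where
    L: "Vector_Spaces.linear (*s) (*s) L" and bij: "bij_betw (\<lambda>z. p + L z) UNIV P"
    and psc: "pseudoconvex {z. p + L z \<in> P \<inter> D}"
    unfolding pseudoconvex_in_plane_def by blast
  have L_add: "L (u + v) = L u + L v" and L_scale: "L (k *s u) = k *s L u" for u v k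
    using L unfolding Vector_Spaces.linear_iff by auto
  have L_diff: "L (u - v) = L u - L v" for u v
    using L_add[of "u - v" v] by simp
  have surj: "\<exists>z. y = p + L z" if "y \<in> P" for y
    using bij that unfolding bij_betw_def by auto
  obtain x' where x': "x = p + L x'" using surj[of x] inP[of 0 0] by auto
  obtain w1 where w1: "x + w = p + L w1" using surj[of "x + w"] inP[of 1 0] by auto
  obtain n1 where n1: "x + n = p + L n1" using surj[of "x + n"] inP[of 0 1] by auto
  have w': "L (w1 - x') = w" and n': "L (n1 - x') = n"
    unfolding L_diff using x' w1 n1 by (simp_all add: algebra_simps)
  have eq: "p + L (x' + \<alpha> *s (w1 - x') + \<beta> *s (n1 - x')) = x + \<alpha> *s w + \<beta> *s n" for \<alpha> \<beta>
    unfolding L_add L_scale w' n' by (simp add: x')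
  have "x \<notin> D" using inside x by simp
  then have out: "x' \<notin> {z. p + L z \<in> P \<inter> D}" using x' by simp
  have disc: "x' + \<tau> *s (w1 - x') + (t + q * \<tau>\<^sup>2) *s (n1 - x') \<in> {z. p + L z \<in> P \<inter> D}"
    if "norm \<tau> \<le> \<rho>" "norm t \<le> \<rho>" "Re t - c * (norm \<tau>)\<^sup>2 + K * (norm n)\<^sup>2 * (norm t)\<^sup>2 < 0" for \<tau> t
    unfolding mem_Collect_eq eq using sub[OF that] inP by blast
  have "K * (norm n)\<^sup>2 \<ge> 0" using \<eta> by simp
  from not_pseudoconvex_of_disc_family[OF psc c(1) this \<rho> disc out]
  show False by blast
qed

end

section \<open>Boundaries that are locally conic\<close>

text \<open>The square of \<open>g\<close> times \<open>exp (- 2 * K * t)\<close> is nonincreasing,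
  and times \<open>exp (2 * K * t)\<close> nondecreasing, so a zero at \<open>s\<close> spreads to
  both sides. Squaring avoids differentiating an absolute value.\<close>

lemma Gronwall_zero:
  fixes g :: "real \<Rightarrow> real"
  assumes der: "\<And>t. p \<le> t \<Longrightarrow> t \<le> q \<Longrightarrow> (g has_real_derivative g' t) (at t)"
    and bound: "\<And>t. p \<le> t \<Longrightarrow> t \<le> q \<Longrightarrow> \<bar>g' t\<bar> \<le> K * \<bar>g t\<bar>"
    and s: "p \<le> s" "s \<le> q" "g s = 0" and t: "p \<le> t" "t \<le> q"
  shows "g t = 0"
proof -
  have bound2: "\<bar>2 * g x * g' x\<bar> \<le> 2 * K * (g x)\<^sup>2" if "p \<le> x" "x \<le> q" for x
  proof -
    have "\<bar>g x\<bar> * \<bar>g' x\<bar> \<le> \<bar>g x\<bar> * (K * \<bar>g x\<bar>)" by (intro mult_left_mono bound that) simp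
    also have "\<dots> = K * (g x)\<^sup>2" by (simp add: power2_eq_square)
    finally show ?thesis by (simp add: abs_mult)
  qed
  have der2: "((\<lambda>t. (g t)\<^sup>2 * exp (k * t)) has_real_derivative (2 * g x * g' x + k * (g x)\<^sup>2) * exp (k * x)) (at x)"
    if "p \<le> x" "x \<le> q" for x k
    by (rule derivative_eq_intros der[OF that] refl | simp add: algebra_simps)+
  have "(g t)\<^sup>2 \<le> 0"
  proof (cases "s \<le> t")
    case True
    have "(g t)\<^sup>2 * exp (- 2 * K * t) \<le> (g s)\<^sup>2 * exp (- 2 * K * s)"
    proof (rule DERIV_nonpos_imp_nonincreasing[OF True])
      fix x assume x: "s \<le> x" "x \<le> t"
      have x': "p \<le> x" "x \<le> q" using s t x by auto
      have "(2 * g x * g' x + (- 2 * K) * (g x)\<^sup>2) * exp ((- 2 * K) * x) \<le> 0"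
        using bound2[OF x'] by (intro mult_nonpos_nonneg) auto
      then show "\<exists>y. ((\<lambda>t. (g t)\<^sup>2 * exp (- 2 * K * t)) has_real_derivative y) (at x) \<and> y \<le> 0"
        using der2[OF x', of "- 2 * K"] by blast
    qed
    then show ?thesis using s by (simp add: mult_le_0_iff)
  next
    case False
    then have ts: "t \<le> s" by simp
    have "(g t)\<^sup>2 * exp (2 * K * t) \<le> (g s)\<^sup>2 * exp (2 * K * s)"
    proof (rule DERIV_nonneg_imp_nondecreasing[OF ts])
      fix x assume x: "t \<le> x" "x \<le> s"
      have x': "p \<le> x" "x \<le> q" using s t x by auto
      have "0 \<le> (2 * g x * g' x + (2 * K) * (g x)\<^sup>2) * exp ((2 * K) * x)"
        using bound2[OF x'] by (intro mult_nonneg_nonneg) auto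
      then show "\<exists>y. ((\<lambda>t. (g t)\<^sup>2 * exp (2 * K * t)) has_real_derivative y) (at x) \<and> 0 \<le> y"
        using der2[OF x', of "2 * K"] by blast
    qed
    then show ?thesis using s by (simp add: mult_le_0_iff)
  qed
  then show ?thesis by simp
qed

context C2_boundary
begin

lemma continuous_r': "continuous_on U r'"
  using r'' by (meson has_derivative_continuous continuous_at_imp_continuous_on)

lemma continuous_cpart: "continuous_on X f \<Longrightarrow> f ` X \<subseteq> U \<Longrightarrow> continuous_on X (\<lambda>x. cpart (r' (f x)) v)"
  unfolding cpart_def Complex_eq
  by (intro continuous_intros continuous_on_compose2[OF continuous_r']) auto

text \<open>At nearby points \<open>w\<close> need not be complex tangent; subtracting a multiple of
  the gradient at \<open>x\<close> restores tangency, and both the correction and the Levi form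
  depend continuously on the point.\<close>

lemma Levi_negative_nearby:
  assumes x: "x \<in> U" and w: "cpart (r' x) w = 0" "Levi x w < 0" and nz: "r' x \<noteq> 0"
  obtains V where "open V" "x \<in> V" "V \<subseteq> U" "\<And>y. y \<in> V \<Longrightarrow> \<exists>v. cpart (r' y) v = 0 \<and> Levi y v < 0"
proof -
  define \<nu> where "\<nu> = gradient (r' x)"
  define k where "k = (\<lambda>y. cpart (r' y) \<nu>)"
  have contk: "continuous_on U k" unfolding k_def by (intro continuous_cpart continuous_intros) auto
  have kx: "k x \<noteq> 0"
  proof -
    have "Re (k x) = (norm (r' x))\<^sup>2"
      by (simp add: k_def Re_cpart \<nu>_def blinfun_eq_inner_gradient dot_square_norm norm_gradient)
    then show ?thesis using nz by auto
  qed
  define V1 where "V1 = U \<inter> k -` (- {0})"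
  have V1: "open V1" unfolding V1_def by (intro continuous_open_preimage contk open_U) auto
  have V1U: "V1 \<subseteq> U" by (auto simp: V1_def)
  define v where "v = (\<lambda>y. w - (cpart (r' y) w / k y) *s \<nu>)"
  have contv: "continuous_on V1 v"
    unfolding v_def using V1U
    by (intro continuous_intros continuous_cpart continuous_on_subset[OF contk]) (auto simp: V1_def)
  have cv: "cpart (r' y) (v y) = 0" if "y \<in> V1" for y
  proof -
    have "cpart (r' y) \<nu> = k y" by (simp add: k_def)
    then show ?thesis using that by (simp add: v_def cpart_diff cpart_smult V1_def)
  qed
  have contL: "continuous_on V1 (\<lambda>y. Levi y (v y))"
    unfolding Levi_def by (intro continuous_intros contv continuous_on_subset[OF cont_r'' V1U])
  define V where "V = V1 \<inter> (\<lambda>y. Levi y (v y)) -` {..<0}"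
  show thesis
  proof
    show "open V" unfolding V_def by (intro continuous_open_preimage contL V1) auto
    show "x \<in> V" using x kx w by (simp add: V_def V1_def v_def)
    show "V \<subseteq> U" using V1U by (auto simp: V_def)
    show "\<exists>v. cpart (r' y) v = 0 \<and> Levi y v < 0" if "y \<in> V" for y
      using that cv by (auto simp: V_def)
  qed
qed

text \<open>On the boundary the hypothesis kills the radial derivative; moving along the gradient to the
  boundary transfers this to a Lipschitz estimate off it.\<close>

lemma radial_derivative_bound:
  assumes x: "x \<in> U" "r x = 0" and V: "open V" "x \<in> V" "V \<subseteq> U"
    and tang: "\<And>y. y \<in> V \<Longrightarrow> r y = 0 \<Longrightarrow> r' y (y - a) = 0"
  obtains \<rho> K where "\<rho> > 0" "ball x \<rho> \<subseteq> V" "K \<ge> 0" "\<And>y. y \<in> ball x \<rho> \<Longrightarrow> \<bar>r' y (y - a)\<bar> \<le> K * \<bar>r y\<bar>"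
proof -
  define \<nu> where "\<nu> = gradient (r' x) /\<^sub>R norm (r' x)"
  have nz: "norm (r' x) > 0" using nonzero x by simp
  have \<nu>: "norm \<nu> = 1" "r' x \<nu> = norm (r' x)"
    using nz by (simp_all add: \<nu>_def norm_gradient blinfun_eq_inner_gradient dot_square_norm power2_eq_square)
  define m where "m = norm (r' x) / 2"
  have m: "m > 0" "m < r' x \<nu>" using nz \<nu> by (simp_all add: m_def)
  have cr': "isCont r' x" using r''[OF x(1)] by (rule has_derivative_continuous)
  have cr'': "isCont r'' x" using cont_r'' open_U x(1) by (simp add: continuous_on_eq_continuous_at)
  have cr: "isCont r x" using r'[OF x(1)] by (rule has_derivative_continuous)
  define B where "B = norm (r'' x) + 1"
  define C where "C = norm (r' x) + 1"
  have BC: "B \<ge> 0" "C \<ge> 0" by (simp_all add: B_def C_def)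
  have "\<forall>\<^sub>F y in nhds x. y \<in> V" by (rule eventually_nhds_in_open[OF V(1,2)])
  moreover have "\<forall>\<^sub>F y in nhds x. m < r' y \<nu>"
  proof (rule order_tendstoD(1)[OF _ m(2)])
    show "((\<lambda>y. r' y \<nu>) \<longlongrightarrow> r' x \<nu>) (nhds x)"
      using cr' by (intro tendsto_intros) (simp add: isCont_def tendsto_nhds_iff)
  qed
  moreover have "\<forall>\<^sub>F y in nhds x. norm (r'' y) < B"
  proof (rule order_tendstoD(2))
    show "((\<lambda>y. norm (r'' y)) \<longlongrightarrow> norm (r'' x)) (nhds x)"
      using cr'' by (intro tendsto_intros) (simp add: isCont_def tendsto_nhds_iff)
  qed (simp add: B_def)
  moreover have "\<forall>\<^sub>F y in nhds x. norm (r' y) < C"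
  proof (rule order_tendstoD(2))
    show "((\<lambda>y. norm (r' y)) \<longlongrightarrow> norm (r' x)) (nhds x)"
      using cr' by (intro tendsto_intros) (simp add: isCont_def tendsto_nhds_iff)
  qed (simp add: C_def)
  ultimately have "\<forall>\<^sub>F y in nhds x. y \<in> V \<and> m < r' y \<nu> \<and> norm (r'' y) < B \<and> norm (r' y) < C"
    by eventually_elim simp
  then obtain \<rho> where \<rho>: "\<rho> > 0" and near: "\<And>y. y \<in> ball x \<rho> \<Longrightarrow> y \<in> V \<and> m < r' y \<nu> \<and> norm (r'' y) < B \<and> norm (r' y) < C"
    unfolding eventually_nhds_metric by (auto simp: dist_commute)
  have "\<forall>\<^sub>F y in nhds x. \<bar>r y\<bar> < m * (\<rho> / 2)"
  proof (rule order_tendstoD(2))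
    show "((\<lambda>y. \<bar>r y\<bar>) \<longlongrightarrow> \<bar>r x\<bar>) (nhds x)"
      using cr by (intro tendsto_intros) (simp add: isCont_def tendsto_nhds_iff)
  qed (use m \<rho> x in simp)
  then obtain \<rho>1 where \<rho>1: "\<rho>1 > 0" and small: "\<And>y. y \<in> ball x \<rho>1 \<Longrightarrow> \<bar>r y\<bar> < m * (\<rho> / 2)"
    unfolding eventually_nhds_metric by (auto simp: dist_commute)
  \<comment> \<open>A Lipschitz constant for \<open>r' y (y - a)\<close> as a function of
    \<open>y\<close> on the ball.\<close>
  define L where "L = B * (norm (x - a) + \<rho>) + C"
  have L: "L \<ge> 0" using BC \<rho> by (simp add: L_def)
  have lip: "\<bar>r' y (y - a) - r' z (z - a)\<bar> \<le> L * norm (y - z)" if "y \<in> ball x \<rho>" "z \<in> ball x \<rho>" for y z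
  proof -
    have "norm (r' y - r' z) \<le> B * norm (y - z)"
    proof (rule differentiable_bound[of "ball x \<rho>" r' "\<lambda>y. blinfun_apply (r'' y)" B])
      show "(r' has_derivative blinfun_apply (r'' p)) (at p within ball x \<rho>)" if "p \<in> ball x \<rho>" for p
        using r'' near[OF that] V by (blast intro: has_derivative_at_withinI)
      show "onorm (blinfun_apply (r'' p)) \<le> B" if "p \<in> ball x \<rho>" for p
        using near[OF that] by (simp add: norm_blinfun.rep_eq less_imp_le)
    qed (use that in auto)
    then have "norm (r' y - r' z) * norm (y - a) \<le> (B * norm (y - z)) * (norm (x - a) + \<rho>)"
    proof (rule mult_mono)
      show "norm (y - a) \<le> norm (x - a) + \<rho>"
        using that(1) norm_triangle_ineq[of "y - x" "x - a"] by (simp add: dist_norm norm_minus_commute)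
    qed (use BC in auto)
    moreover have "\<bar>(r' y - r' z) (y - a)\<bar> \<le> norm (r' y - r' z) * norm (y - a)"
      using norm_blinfun[of "r' y - r' z" "y - a"] by simp
    moreover have "\<bar>r' z (y - z)\<bar> \<le> C * norm (y - z)"
    proof -
      have "\<bar>r' z (y - z)\<bar> \<le> norm (r' z) * norm (y - z)" using norm_blinfun[of "r' z" "y - z"] by simp
      also have "\<dots> \<le> C * norm (y - z)" using near[OF that(2)] by (intro mult_right_mono) auto
      finally show ?thesis .
    qed
    moreover have "r' y (y - a) - r' z (z - a) = (r' y - r' z) (y - a) + r' z (y - z)"
      by (simp add: blinfun.diff_left blinfun.diff_right)
    ultimately show ?thesis by (simp add: L_def algebra_simps)
  qed
  show thesis
  proof
    show "min (\<rho> / 2) \<rho>1 > 0" "L / m \<ge> 0" using \<rho> \<rho>1 L m by auto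
    show "ball x (min (\<rho> / 2) \<rho>1) \<subseteq> V" using near \<rho> by auto
    fix y assume y: "y \<in> ball x (min (\<rho> / 2) \<rho>1)"
    \<comment> \<open>Along \<nu> the function \<open>r\<close> grows at a rate of at least
      \<open>m\<close>, so it has a zero within the distance \<open>s\<close> on one side or the
      other.\<close>
    define s where "s = \<bar>r y\<bar> / m"
    have s: "0 \<le> s" "s < \<rho> / 2" using small[of y] y m by (auto simp: s_def pos_divide_less_eq mult.commute)
    have inb: "y + t *\<^sub>R \<nu> \<in> ball x \<rho>" if "\<bar>t\<bar> \<le> s" for t
    proof -
      have "norm (y + t *\<^sub>R \<nu> - x) \<le> norm (y - x) + norm (t *\<^sub>R \<nu>)"
        using norm_triangle_ineq[of "y - x" "t *\<^sub>R \<nu>"] by (simp add: algebra_simps)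
      also have "\<dots> < \<rho>" using y s that \<nu> by (simp add: dist_norm norm_minus_commute)
      finally show ?thesis by (simp add: dist_norm norm_minus_commute)
    qed
    define f where "f = (\<lambda>t. r (y + t *\<^sub>R \<nu>) - m * t)"
    have der: "(f has_real_derivative (r' (y + t *\<^sub>R \<nu>) \<nu> - m)) (at t)" if "\<bar>t\<bar> \<le> s" for t
    proof -
      have U: "y + t *\<^sub>R \<nu> \<in> U" using near[OF inb[OF that]] V by auto
      have "((\<lambda>t. y + t *\<^sub>R \<nu>) has_derivative (\<lambda>s. s *\<^sub>R \<nu>)) (at t)"
        by (auto intro!: derivative_eq_intros)
      from has_derivative_compose[OF this r'[OF U]]
      have "((\<lambda>s. r (y + s *\<^sub>R \<nu>)) has_real_derivative r' (y + t *\<^sub>R \<nu>) \<nu>) (at t)"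
        by (simp add: has_field_derivative_def blinfun.scaleR_right mult.commute[of _ "blinfun_apply _ _"])
      then show ?thesis unfolding f_def by (auto intro!: derivative_eq_intros)
    qed
    have mono: "f t \<le> f t'" if "t \<le> t'" "\<bar>t\<bar> \<le> s" "\<bar>t'\<bar> \<le> s" for t t'
    proof (rule DERIV_nonneg_imp_nondecreasing[OF that(1)])
      fix p assume "t \<le> p" "p \<le> t'"
      then have p: "\<bar>p\<bar> \<le> s" using that by auto
      then show "\<exists>y. (f has_real_derivative y) (at p) \<and> 0 \<le> y"
        using der[OF p] near[OF inb[OF p]] by (intro exI[of _ "r' (y + p *\<^sub>R \<nu>) \<nu> - m"]) auto
    qed
    have ms: "m * s = \<bar>r y\<bar>" using m by (simp add: s_def)
    have "r (y + (- s) *\<^sub>R \<nu>) \<le> 0" using mono[of "- s" 0] s ms by (simp add: f_def)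
    moreover have "0 \<le> r (y + s *\<^sub>R \<nu>)" using mono[of 0 s] s ms by (simp add: f_def)
    moreover have "continuous_on {- s..s} (\<lambda>t. r (y + t *\<^sub>R \<nu>))"
    proof -
      have "continuous_on {- s..s} f"
        using DERIV_isCont[OF der] by (intro continuous_at_imp_continuous_on ballI) auto
      then have "continuous_on {- s..s} (\<lambda>t. f t + m * t)" by (intro continuous_intros)
      then show ?thesis by (simp add: f_def)
    qed
    ultimately obtain t where t: "- s \<le> t" "t \<le> s" "r (y + t *\<^sub>R \<nu>) = 0"
      using IVT'[of "\<lambda>t. r (y + t *\<^sub>R \<nu>)" "- s" 0 s] s by auto
    define z where "z = y + t *\<^sub>R \<nu>"
    have z: "z \<in> ball x \<rho>" unfolding z_def using t by (intro inb) auto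
    have "r' z (z - a) = 0" using tang[of z] near[OF z] t(3) by (simp add: z_def)
    moreover have "y \<in> ball x \<rho>" using y \<rho> by auto
    ultimately have "\<bar>r' y (y - a)\<bar> \<le> L * norm (y - z)" using lip[of y z] z by simp
    also have "\<dots> \<le> L * s" using t \<nu> L by (intro mult_left_mono) (auto simp: z_def)
    finally show "\<bar>r' y (y - a)\<bar> \<le> L / m * \<bar>r y\<bar>" by (simp add: s_def)
  qed
qed

text \<open>On a ray from \<open>a\<close>, the radial bound becomes a linear differential
  inequality for \<open>g\<close>, so by Gronwall \<open>g\<close> vanishes identically or nowhere
  and keeps its sign. The bound controls \<open>t * g' t\<close>; as \<epsilon> is at most 1/2,
  dividing by \<open>t\<close> costs only the factor 2.\<close>

lemma local_cone:
  assumes x: "x \<in> U" "r x = 0" and V: "open V" "x \<in> V" "V \<subseteq> U"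
    and tang: "\<And>y. y \<in> V \<Longrightarrow> r y = 0 \<Longrightarrow> r' y (y - a) = 0"
  obtains \<rho> \<epsilon> where "\<rho> > 0" "0 < \<epsilon>" "\<epsilon> < 1"
    "\<And>y l. y \<in> ball x \<rho> \<Longrightarrow> 1 - \<epsilon> \<le> l \<Longrightarrow> l \<le> 1 \<Longrightarrow> a + l *\<^sub>R (y - a) \<in> U \<and> sgn (r (a + l *\<^sub>R (y - a))) = sgn (r y)"
proof -
  obtain \<rho> K where \<rho>: "\<rho> > 0" "ball x \<rho> \<subseteq> V" "K \<ge> 0" and bound: "\<And>y. y \<in> ball x \<rho> \<Longrightarrow> \<bar>r' y (y - a)\<bar> \<le> K * \<bar>r y\<bar>"
    by (rule radial_derivative_bound[OF x V tang]) (auto intro: that)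
  define R where "R = norm (x - a) + \<rho>"
  have R: "R > 0" using \<rho> by (simp add: R_def add_nonneg_pos)
  define \<epsilon> where "\<epsilon> = min (1/2) (\<rho> / (2 * R))"
  have \<epsilon>: "0 < \<epsilon>" "\<epsilon> \<le> 1/2" using \<rho> R by (simp_all add: \<epsilon>_def)
  have "a + l *\<^sub>R (y - a) \<in> U \<and> sgn (r (a + l *\<^sub>R (y - a))) = sgn (r y)"
    if y: "y \<in> ball x (\<rho> / 2)" and l: "1 - \<epsilon> \<le> l" "l \<le> 1" for y l
  proof -
    have inb: "a + t *\<^sub>R (y - a) \<in> ball x \<rho>" if t: "1 - \<epsilon> \<le> t" "t \<le> 1" for t
    proof -
      have "norm (y - a) \<le> R"
        using y norm_triangle_ineq[of "y - x" "x - a"] \<rho> by (simp add: R_def dist_norm norm_minus_commute)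
      then have "(1 - t) * norm (y - a) \<le> \<rho> / (2 * R) * R"
        using t R \<rho> by (intro mult_mono) (auto simp: \<epsilon>_def)
      also have "\<dots> = \<rho> / 2" using R by simp
      finally have "norm ((1 - t) *\<^sub>R (y - a)) \<le> \<rho> / 2" using t by simp
      moreover have "a + t *\<^sub>R (y - a) - x = (y - x) - (1 - t) *\<^sub>R (y - a)"
        by (simp add: algebra_simps)
      ultimately have "norm (a + t *\<^sub>R (y - a) - x) < \<rho>"
        using norm_triangle_ineq4[of "y - x" "(1 - t) *\<^sub>R (y - a)"] y
        by (simp only:) (simp add: dist_norm norm_minus_commute)
      then show ?thesis by (simp add: dist_norm norm_minus_commute)
    qed
    define g where "g = (\<lambda>t. r (a + t *\<^sub>R (y - a)))"
    define g' where "g' = (\<lambda>t. r' (a + t *\<^sub>R (y - a)) (y - a))"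
    have der: "(g has_real_derivative g' t) (at t)" if "1 - \<epsilon> \<le> t" "t \<le> 1" for t
    proof -
      have U: "a + t *\<^sub>R (y - a) \<in> U" using inb[OF that] \<rho> V by auto
      have "((\<lambda>t. a + t *\<^sub>R (y - a)) has_derivative (\<lambda>s. s *\<^sub>R (y - a))) (at t)"
        by (auto intro!: derivative_eq_intros)
      from has_derivative_compose[OF this r'[OF U]] show ?thesis
        by (simp add: has_field_derivative_def blinfun.scaleR_right mult.commute[of _ "blinfun_apply _ _"] g_def g'_def)
    qed
    have bd: "\<bar>g' t\<bar> \<le> (2 * K) * \<bar>g t\<bar>" if t: "1 - \<epsilon> \<le> t" "t \<le> 1" for t
    proof -
      have "t * \<bar>g' t\<bar> \<le> K * \<bar>g t\<bar>"
        using bound[OF inb[OF t]] t \<epsilon> by (simp add: g_def g'_def blinfun.scaleR_right abs_mult)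
      moreover have "1 / 2 * \<bar>g' t\<bar> \<le> t * \<bar>g' t\<bar>" using t \<epsilon> by (intro mult_right_mono) auto
      ultimately show ?thesis by simp
    qed
    have zero: "g s = 0 \<Longrightarrow> 1 - \<epsilon> \<le> s \<Longrightarrow> s \<le> 1 \<Longrightarrow> 1 - \<epsilon> \<le> t \<Longrightarrow> t \<le> 1 \<Longrightarrow> g t = 0" for s t
      by (rule Gronwall_zero[of "1 - \<epsilon>" 1 g g', OF der bd])
    have contg: "continuous_on {l..1} g"
      using DERIV_isCont[OF der] l by (intro continuous_at_imp_continuous_on ballI) auto
    have "sgn (g l) = sgn (g 1)"
    proof (rule ccontr)
      assume neq: "sgn (g l) \<noteq> sgn (g 1)"
      have "\<exists>s. l \<le> s \<and> s \<le> 1 \<and> g s = 0"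
      proof (cases "g l \<le> 0")
        case True
        then have "0 \<le> g 1" using neq zero[of l 1] l \<epsilon> by (cases "g l = 0") (auto simp: sgn_if split: if_splits)
        then show ?thesis using IVT'[of g l 0 1] True l contg by auto
      next
        case False
        then have "g 1 \<le> 0" using neq by (auto simp: sgn_if split: if_splits)
        then show ?thesis using IVT2'[of g 1 0 l] False l contg by auto
      qed
      then obtain s where s: "l \<le> s" "s \<le> 1" "g s = 0" by blast
      have "g l = 0" "g 1 = 0" using zero[of s l] zero[of s 1] s l \<epsilon> by auto
      then show False using neq by simp
    qed
    moreover have "a + l *\<^sub>R (y - a) \<in> U" using inb[OF l] \<rho> V by auto
    ultimately show ?thesis by (simp add: g_def)
  qed
  then show thesis using that[of "\<rho> / 2" \<epsilon>] \<rho> \<epsilon> by auto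
qed

end

section \<open>Dilation towards the exceptional point and the extremal argument\<close>

text \<open>Substitute \<tau> = \<sigma> / l: the dilated disc keeps the tangent vector
  \<open>w\<close>, its quadratic coefficient becomes \<open>q / l\<close>, and the radius
  \<open>l * (c * (norm \<tau>)\<^sup>2)\<close> equals
  \<open>c / l * (norm \<sigma>)\<^sup>2\<close>. Dilation is assumed to preserve \<open>D\<close>
  only near \<open>x\<close>, so \<open>\<eta>'\<close> also keeps the balls inside
  \<open>ball x \<rho>\<close>.\<close>

lemma inner_disc_dilate:
  assumes \<rho>: "\<rho> > 0" and l: "l > 0"
    and dil: "\<And>y. y \<in> ball x \<rho> \<Longrightarrow> y \<in> D \<Longrightarrow> a + l *\<^sub>R (y - a) \<in> D"
    and disc: "inner_disc D c x w"
  shows "inner_disc D (c / l) (a + l *\<^sub>R (x - a)) w"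
proof -
  obtain q \<eta> where \<eta>: "\<eta> > 0" and
    q: "\<And>\<tau>. \<tau> \<noteq> 0 \<and> norm \<tau> < \<eta> \<Longrightarrow> ball (x + \<tau> *s w + \<tau>\<^sup>2 *s q) (c * (norm \<tau>)\<^sup>2) \<subseteq> D"
    using disc unfolding inner_disc_def by blast
  define N where "N = norm w + norm q + \<bar>c\<bar> + 1"
  have N: "N > 0" by (simp add: N_def add_nonneg_pos)
  define \<eta>' where "\<eta>' = l * Min {1, \<eta>, \<rho> / N}"
  have \<eta>': "\<eta>' > 0" using \<eta> \<rho> l N by (simp add: \<eta>'_def)
  have "ball (a + l *\<^sub>R (x - a) + \<sigma> *s w + \<sigma>\<^sup>2 *s (of_real (1 / l) *s q)) (c / l * (norm \<sigma>)\<^sup>2) \<subseteq> D"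
    if \<sigma>: "\<sigma> \<noteq> 0" "norm \<sigma> < \<eta>'" for \<sigma>
  proof
    fix p assume p: "p \<in> ball (a + l *\<^sub>R (x - a) + \<sigma> *s w + \<sigma>\<^sup>2 *s (of_real (1 / l) *s q)) (c / l * (norm \<sigma>)\<^sup>2)"
    define \<tau> where "\<tau> = \<sigma> / of_real l"
    have \<sigma>\<tau>: "\<sigma> = of_real l * \<tau>" using l by (simp add: \<tau>_def)
    have n\<sigma>: "norm \<sigma> = l * norm \<tau>" using l by (simp add: \<sigma>\<tau> norm_mult)
    have "norm \<tau> < Min {1, \<eta>, \<rho> / N}"
      using \<sigma>(2) l unfolding \<eta>'_def n\<sigma> by (simp only: mult_less_cancel_left_pos)
    then have \<tau>: "\<tau> \<noteq> 0" "norm \<tau> < \<eta>" "norm \<tau> < 1" "norm \<tau> < \<rho> / N" using \<sigma> \<sigma>\<tau> by auto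
    define y where "y = a + (1 / l) *\<^sub>R (p - a)"
    have py: "p = a + l *\<^sub>R (y - a)" using l by (simp add: y_def)
    define m where "m = x + \<tau> *s w + \<tau>\<^sup>2 *s q"
    have "a + l *\<^sub>R (x - a) + \<sigma> *s w + \<sigma>\<^sup>2 *s (of_real (1 / l) *s q) = a + l *\<^sub>R (m - a)"
      using l unfolding m_def \<sigma>\<tau> smult_of_real[symmetric]
      by (vector power2_eq_square field_simps)
    then have "p \<in> ball (a + l *\<^sub>R (m - a)) (c / l * (norm \<sigma>)\<^sup>2)"
      using p by (simp only:)
    then have "dist (a + l *\<^sub>R (m - a)) (a + l *\<^sub>R (y - a)) < c / l * (norm \<sigma>)\<^sup>2"
      by (simp only: mem_ball py[symmetric])
    moreover have "dist (a + l *\<^sub>R (m - a)) (a + l *\<^sub>R (y - a)) = l * dist m y"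
    proof -
      have "a + l *\<^sub>R (m - a) - (a + l *\<^sub>R (y - a)) = l *\<^sub>R (m - y)" by (simp add: algebra_simps)
      then show ?thesis using l by (simp add: dist_norm)
    qed
    moreover have "c / l * (norm \<sigma>)\<^sup>2 = l * (c * (norm \<tau>)\<^sup>2)"
      using l by (simp add: n\<sigma> power2_eq_square)
    ultimately have my: "dist m y < c * (norm \<tau>)\<^sup>2" using l by simp
    then have "y \<in> D" using q[of \<tau>] \<tau> by (auto simp: m_def)
    moreover have "y \<in> ball x \<rho>"
    proof -
      have t2: "(norm \<tau>)\<^sup>2 \<le> norm \<tau>" using \<tau> by (simp add: power2_eq_square mult_left_le)
      have "dist x m = norm (m - x)" by (simp add: dist_norm norm_minus_commute)
      then have "dist x m \<le> norm \<tau> * norm w + (norm \<tau>)\<^sup>2 * norm q"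
        using norm_triangle_ineq[of "\<tau> *s w" "\<tau>\<^sup>2 *s q"]
        by (simp add: m_def norm_smult_vec norm_power add.assoc)
      also have "\<dots> \<le> norm \<tau> * norm w + norm \<tau> * norm q"
        using t2 by (simp add: mult_right_mono)
      finally have "dist x m \<le> norm \<tau> * norm w + norm \<tau> * norm q" .
      moreover have "c * (norm \<tau>)\<^sup>2 \<le> \<bar>c\<bar> * norm \<tau>"
        using t2 by (intro mult_mono) auto
      moreover have "norm \<tau> * N = norm \<tau> * norm w + norm \<tau> * norm q + \<bar>c\<bar> * norm \<tau> + norm \<tau>"
        by (simp add: N_def algebra_simps)
      ultimately have "dist x y \<le> norm \<tau> * N"
        using dist_triangle[of x y m] my norm_ge_zero[of \<tau>] dist_commute[of y m] by linarith
      also have "\<dots> < \<rho>" using \<tau>(4) N by (simp add: pos_less_divide_eq)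
      finally show ?thesis by simp
    qed
    ultimately show "p \<in> D" unfolding py by (intro dil)
  qed
  then show ?thesis unfolding inner_disc_def using \<eta>' by blast
qed

lemma C2_smooth_imp_boundary:
  assumes "C2_smooth D" "b \<in> frontier D"
  obtains U r r' r'' where "C2_boundary D U r r' r''" "b \<in> U"
proof -
  obtain U r where U: "open U" "b \<in> U" "C2_on r U"
    and g: "\<And>x. x \<in> frontier D \<inter> U \<Longrightarrow> \<exists>g. GDERIV r x :> g \<and> g \<noteq> 0"
    and D: "D \<inter> U = {z \<in> U. r z < 0}" "frontier D \<inter> U = {z \<in> U. r z = 0}"
    using assms unfolding C2_smooth_def by meson
  obtain r' r'' where r: "\<And>x. x \<in> U \<Longrightarrow> (r has_derivative blinfun_apply (r' x)) (at x)"
      "\<And>x. x \<in> U \<Longrightarrow> (r' has_derivative blinfun_apply (r'' x)) (at x)" "continuous_on U r''"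
    using U(3) unfolding C2_on_def by blast
  have "C2_boundary D U r r' r''"
  proof
    fix x assume x: "x \<in> U"
    show "x \<in> D \<longleftrightarrow> r x < 0" "x \<in> frontier D \<longleftrightarrow> r x = 0" using D x by blast+
    assume "r x = 0"
    then obtain v where v: "GDERIV r x :> v" "v \<noteq> 0" using g[of x] D x by blast
    have "blinfun_apply (r' x) = (\<lambda>h. inner h v)"
      using has_derivative_unique[OF r(1)[OF x]] v(1) by (simp add: gderiv_def)
    then have "r' x v \<noteq> 0" using v(2) by simp
    then show "r' x \<noteq> 0" by auto
  qed (use U r in auto)
  with U(2) show thesis by (rule that[rotated])
qed

context C2_boundary
begin

text \<open>Letting \<open>c'\<close> tend to \<open>c\<close> recovers the sharp constant, so that
  asking for all smaller constants amounts to a closed condition on the Levi form.\<close>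

lemma inner_discs_imp_Levi:
  assumes x: "x \<in> U" "r x = 0" and c: "c > 0" and disc: "\<And>c'. 0 < c' \<Longrightarrow> c' < c \<Longrightarrow> inner_disc D c' x v"
  shows "cpart (r' x) v = 0" "Levi x v \<le> - 4 * c * norm (r' x)"
proof -
  show "cpart (r' x) v = 0"
    using inner_disc_imp_Levi(1)[OF x _ disc[of "c/2"]] c by simp
  show "Levi x v \<le> - 4 * c * norm (r' x)"
  proof (rule tendsto_lowerbound)
    show "((\<lambda>c'. - 4 * c' * norm (r' x)) \<longlongrightarrow> - 4 * c * norm (r' x)) (at_left c)"
      by (intro tendsto_intros)
    show "\<forall>\<^sub>F c' in at_left c. Levi x v \<le> - 4 * c' * norm (r' x)"
      unfolding eventually_at_left_field
      by (intro exI[of _ 0]) (use c inner_disc_imp_Levi(2)[OF x _ disc] in auto)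
  qed simp
qed

text \<open>The gradient \<open>g\<close> and the tangent vector \<open>w\<close> are independent
  over the reals, so the half ellipse from \<open>x + s *\<^sub>R g\<close> to
  \<open>x - s *\<^sub>R g\<close> through \<open>x + s *\<^sub>R w\<close> avoids \<open>x\<close>,
  and \<open>r\<close> changes sign along it.\<close>

lemma boundary_point_nearby:
  assumes x: "x \<in> U" "r x = 0" and w: "cpart (r' x) w = 0" "w \<noteq> 0" and V: "open V" "x \<in> V" "V \<subseteq> U"
  obtains y where "y \<in> V" "r y = 0" "y \<noteq> x"
proof -
  define g where "g = gradient (r' x)"
  have rg: "r' x g > 0" using nonzero[OF x]
    by (simp add: g_def blinfun_eq_inner_gradient dot_square_norm norm_gradient)
  have rw: "r' x w = 0" using w by (simp add: cpart_eq_0_iff)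
  obtain \<delta> where \<delta>: "\<delta> > 0" "ball x \<delta> \<subseteq> V" using V openE by blast
  have "((\<lambda>t. x + t *\<^sub>R g) has_derivative (\<lambda>s. s *\<^sub>R g)) (at 0)"
    by (auto intro!: derivative_eq_intros)
  moreover have "(r has_derivative blinfun_apply (r' x)) (at (x + 0 *\<^sub>R g))" using r'[OF x(1)] by simp
  ultimately have "((\<lambda>t. r (x + t *\<^sub>R g)) has_derivative (\<lambda>s. r' x (s *\<^sub>R g))) (at 0)"
    by (rule has_derivative_compose)
  then have der: "((\<lambda>t. r (x + t *\<^sub>R g)) has_real_derivative r' x g) (at 0)"
    by (simp add: has_field_derivative_def blinfun.scaleR_right mult.commute[of _ "blinfun_apply _ _"])
  obtain d1 where d1: "d1 > 0" "\<And>h. 0 < h \<Longrightarrow> h < d1 \<Longrightarrow> 0 < r (x + h *\<^sub>R g)"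
    using DERIV_pos_inc_right[OF der rg] x by auto
  obtain d2 where d2: "d2 > 0" "\<And>h. 0 < h \<Longrightarrow> h < d2 \<Longrightarrow> r (x - h *\<^sub>R g) < 0"
    using DERIV_pos_inc_left[OF der rg] x by auto
  define s where "s = Min {d1, d2, \<delta> / (norm g + norm w + 1)} / 2"
  have den: "norm g + norm w + 1 > 0" by (simp add: add_nonneg_pos)
  then have s0: "Min {d1, d2, \<delta> / (norm g + norm w + 1)} > 0" using d1(1) d2(1) \<delta>(1) by simp
  then have "s < Min {d1, d2, \<delta> / (norm g + norm w + 1)}" unfolding s_def by linarith
  then have s: "s < d1" "s < d2" "s < \<delta> / (norm g + norm w + 1)" by auto
  have s1: "0 < s" using s0 by (simp add: s_def)
  define \<gamma> where "\<gamma> = (\<lambda>\<theta>. x + s *\<^sub>R (cos \<theta> *\<^sub>R g + sin \<theta> *\<^sub>R w))"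
  have \<gamma>V: "\<gamma> \<theta> \<in> V" for \<theta>
  proof -
    have "norm (cos \<theta> *\<^sub>R g + sin \<theta> *\<^sub>R w) \<le> norm g + norm w"
      by (rule norm_triangle_le) (simp add: add_mono mult_left_le_one_le)
    then have "s * norm (cos \<theta> *\<^sub>R g + sin \<theta> *\<^sub>R w) \<le> s * (norm g + norm w + 1)"
      using s1 by (intro mult_left_mono) auto
    also have "\<dots> < \<delta>" using s(3) den by (simp add: pos_less_divide_eq)
    finally have "\<gamma> \<theta> \<in> ball x \<delta>" using s1 by (simp add: \<gamma>_def dist_norm)
    then show ?thesis using \<delta> by blast
  qed
  have contr: "continuous_on U r"
    using r' by (meson has_derivative_continuous continuous_at_imp_continuous_on)
  have "continuous_on {0..pi} (\<lambda>\<theta>. r (\<gamma> \<theta>))"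
  proof (rule continuous_on_compose2[OF contr])
    show "continuous_on {0..pi} \<gamma>" unfolding \<gamma>_def by (intro continuous_intros)
  qed (use \<gamma>V V in auto)
  moreover have "r (\<gamma> pi) \<le> 0" "0 \<le> r (\<gamma> 0)"
    using d1(2)[of s] d2(2)[of s] s s1 by (simp_all add: \<gamma>_def)
  ultimately obtain \<theta> where \<theta>: "r (\<gamma> \<theta>) = 0"
    using IVT2'[of "\<lambda>\<theta>. r (\<gamma> \<theta>)" pi 0 0] by auto
  have "\<gamma> \<theta> \<noteq> x"
  proof
    assume "\<gamma> \<theta> = x"
    then have 0: "cos \<theta> *\<^sub>R g + sin \<theta> *\<^sub>R w = 0" using s1 by (simp add: \<gamma>_def)
    have "r' x (cos \<theta> *\<^sub>R g + sin \<theta> *\<^sub>R w) = cos \<theta> * r' x g"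
      by (simp add: blinfun.add_right blinfun.scaleR_right rw)
    then have "cos \<theta> = 0" using 0 rg by simp
    moreover from this have "sin \<theta> = 0" using 0 w(2) by simp
    ultimately show False using sin_cos_squared_add[of \<theta>] by simp
  qed
  with \<theta> \<gamma>V show thesis by (intro that[of "\<gamma> \<theta>"])
qed

end

text \<open>The extremal argument weighs curvature by the distance to \<open>a\<close> and so has to
  start away from \<open>a\<close>. If \<open>b = a\<close>, a neighbouring boundary point serves,
  since negativity of the Levi form is open.\<close>

lemma inner_disc_off_point:
  assumes "C2_smooth D" "b \<in> frontier D" "c > 0" "inner_disc D c b v"
  obtains b' c' v' where "b' \<in> frontier D" "b' \<noteq> a" "c' > 0" "inner_disc D c' b' v'"
proof (cases "b = a")
  case True
  obtain U r r' r'' where "C2_boundary D U r r' r''" and bU: "b \<in> U"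
    by (rule C2_smooth_imp_boundary[OF assms(1,2)])
  interpret C2_boundary D U r r' r'' by fact
  have b: "b \<in> U" "r b = 0" using bU assms(2) frontier by auto
  have v: "cpart (r' b) v = 0" "Levi b v \<le> - 4 * c * norm (r' b)"
    using inner_disc_imp_Levi[OF b assms(3,4)] by auto
  have "0 < 4 * c * norm (r' b)" using assms(3) nonzero[OF b] by simp
  then have neg: "Levi b v < 0" using v by linarith
  obtain V where V: "open V" "b \<in> V" "V \<subseteq> U" and lev: "\<And>y. y \<in> V \<Longrightarrow> \<exists>v. cpart (r' y) v = 0 \<and> Levi y v < 0"
    by (rule Levi_negative_nearby[OF b(1) v(1) neg nonzero[OF b]]) (rule that; assumption)
  have "v \<noteq> 0" using neg by (auto simp: Levi_def)
  then obtain y where y: "y \<in> V" "r y = 0" "y \<noteq> b"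
    by (rule boundary_point_nearby[OF b v(1) _ V])
  have yU: "y \<in> U" using y V by auto
  obtain v' where v': "cpart (r' y) v' = 0" "Levi y v' < 0" using lev[OF y(1)] by blast
  define k where "k = - Levi y v' / (4 * norm (r' y))"
  have ny: "norm (r' y) > 0" using nonzero[OF yU y(2)] by simp
  then have k: "k > 0" "Levi y v' \<le> - 4 * k * norm (r' y)" using v' by (simp_all add: k_def divide_neg_pos)
  have "inner_disc D (k / 2) y v'"
    by (rule Levi_imp_inner_disc[OF yU y(2) k(1) _ v'(1) k(2)]) (use k in simp)
  then show thesis using that[of y "k / 2" v'] k y yU frontier True by auto
qed (use assms that in blast)

text \<open>If the Levi form were negative somewhere, consider the boundary points \<open>b\<close> at which its
  normalised value in a fixed direction is at most \<open>- C / \<bar>b - a\<bar>\<close>. There is one closest to \<open>a\<close>;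
  but the boundary is a cone with vertex \<open>a\<close> near it, and dilating it towards \<open>a\<close> gives a closer one.\<close>

lemma exceptional_point_no_inner_disc:
  fixes D :: "(complex ^ 'n) set"
  assumes D: "open D" "C2_smooth D" and a: "exceptional_point a D"
    and "b \<in> frontier D" "c > 0" "inner_disc D c b v"
  shows False
proof -
  obtain b0 c0 w where b0: "b0 \<in> frontier D" "b0 \<noteq> a" "c0 > 0" "inner_disc D c0 b0 w"
    by (rule inner_disc_off_point[OF D(2) assms(4-6)])
  \<comment> \<open>Then \<open>C / norm (b0 - a) = c0\<close>, which puts \<open>b0\<close> into
    \<open>M\<close>.\<close>
  define C where "C = c0 * norm (b0 - a)"
  have C: "C > 0" using b0 by (simp add: C_def)
  \<comment> \<open>The bound \<open>C / norm (b - a)\<close> scales under dilation towards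
    \<open>a\<close> exactly like the constant of an inner disc. Demanding only the constants below
    it makes the condition closed away from \<open>a\<close>, as the limit \<open>b1\<close>
    requires.\<close>
  define M where "M = {b \<in> frontier D. b \<noteq> a \<and> (\<forall>c' < C / norm (b - a). inner_disc D c' b w)}"
  have "b0 \<in> M" using b0 by (auto simp: M_def C_def intro: inner_disc_antimono)
  then have ne: "(\<lambda>b. norm (b - a)) ` M \<noteq> {}" by auto
  define d where "d = Inf ((\<lambda>b. norm (b - a)) ` M)"
  have d_le: "d \<le> norm (b - a)" if "b \<in> M" for b
    unfolding d_def by (rule cInf_lower) (use that in \<open>auto intro!: bdd_belowI[of _ 0]\<close>)
  have "\<exists>b\<in>M. norm (b - a) < d + inverse (real (Suc k))" for k
  proof -
    have "Inf ((\<lambda>b. norm (b - a)) ` M) < d + inverse (real (Suc k))" by (simp add: d_def)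
    then show ?thesis using cInf_lessD[OF ne] by auto
  qed
  then obtain X where X: "\<And>k. X k \<in> M" "\<And>k. norm (X k - a) < d + inverse (real (Suc k))" by metis
  have Xd: "(\<lambda>k. norm (X k - a)) \<longlonglongrightarrow> d"
  proof (rule real_tendsto_sandwich)
    show "\<forall>\<^sub>F k in sequentially. d \<le> norm (X k - a)" using d_le X(1) by simp
    show "\<forall>\<^sub>F k in sequentially. norm (X k - a) \<le> d + inverse (real (Suc k))"
      using X(2) by (intro always_eventually allI less_imp_le)
    show "(\<lambda>k. d + inverse (real (Suc k))) \<longlonglongrightarrow> d"
      using tendsto_add[OF tendsto_const LIMSEQ_inverse_real_of_nat, of d] by simp
  qed simp
  have "compact (frontier D \<inter> cball a (d + 1))"
    by (intro closed_Int_compact frontier_closed compact_cball)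
  moreover have "X k \<in> frontier D \<inter> cball a (d + 1)" for k
  proof -
    have "inverse (real (Suc k)) \<le> 1" by (simp add: inverse_le_1_iff)
    then show ?thesis using X[of k] by (auto simp: M_def dist_norm norm_minus_commute)
  qed
  ultimately obtain b1 \<phi> where b1: "b1 \<in> frontier D" "strict_mono \<phi>" "(X \<circ> \<phi>) \<longlonglongrightarrow> b1"
    unfolding compact_def by (metis (no_types, lifting) Int_iff)
  define Y where "Y = (\<lambda>k. X (\<phi> k))"
  have Y: "Y \<longlonglongrightarrow> b1" "\<And>k. Y k \<in> M" using b1(3) X(1) by (simp_all add: Y_def o_def)
  have nY: "(\<lambda>k. norm (Y k - a)) \<longlonglongrightarrow> norm (b1 - a)" by (intro tendsto_intros Y)
  moreover have "(\<lambda>k. norm (Y k - a)) \<longlonglongrightarrow> d"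
    using LIMSEQ_subseq_LIMSEQ[OF Xd b1(2)] by (simp add: Y_def o_def)
  ultimately have nb1: "norm (b1 - a) = d" by (rule LIMSEQ_unique)
  obtain U r r' r'' where "C2_boundary D U r r' r''" and bU: "b1 \<in> U"
    by (rule C2_smooth_imp_boundary[OF D(2) b1(1)])
  interpret C2_boundary D U r r' r'' by fact
  have b: "b1 \<in> U" "r b1 = 0" using bU b1(1) frontier by auto
  have nz: "norm (r' b1) > 0" using nonzero[OF b] by simp
  have YU: "\<forall>\<^sub>F k in sequentially. Y k \<in> U" using Y(1) open_U bU topological_tendstoD by blast
  have Y_Levi: "cpart (r' (Y k)) w = 0 \<and> Levi (Y k) w * norm (Y k - a) \<le> - 4 * C * norm (r' (Y k))"
    if "Y k \<in> U" for k
  proof -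
    have Yk: "Y k \<noteq> a" "r (Y k) = 0" "\<And>c'. c' < C / norm (Y k - a) \<Longrightarrow> inner_disc D c' (Y k) w"
      using Y(2)[of k] that frontier by (auto simp: M_def)
    have pos: "C / norm (Y k - a) > 0" using C Yk(1) by simp
    have "Levi (Y k) w \<le> - 4 * (C / norm (Y k - a)) * norm (r' (Y k))" "cpart (r' (Y k)) w = 0"
      using inner_discs_imp_Levi[OF that Yk(2) pos] Yk(3) by auto
    moreover from this(1) have "Levi (Y k) w * norm (Y k - a) \<le> - 4 * (C / norm (Y k - a)) * norm (r' (Y k)) * norm (Y k - a)"
      by (rule mult_right_mono) simp
    ultimately show ?thesis using Yk(1) by simp
  qed
  have tr': "(\<lambda>k. r' (Y k)) \<longlonglongrightarrow> r' b1"
    using has_derivative_continuous[OF r''[OF bU]] Y(1) by (rule isCont_tendsto_compose)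
  have tr'': "(\<lambda>k. r'' (Y k)) \<longlonglongrightarrow> r'' b1"
    using cont_r'' open_U bU Y(1) by (metis continuous_on_eq_continuous_at isCont_tendsto_compose)
  have w1: "cpart (r' b1) w = 0"
  proof -
    have "r' b1 v = 0" if ev: "\<And>k. Y k \<in> U \<Longrightarrow> r' (Y k) v = 0" for v
    proof -
      have "(\<lambda>k. r' (Y k) v) \<longlonglongrightarrow> r' b1 v" by (intro tendsto_intros tr')
      moreover have "(\<lambda>k. r' (Y k) v) \<longlonglongrightarrow> 0"
        using YU ev by (intro tendsto_eventually) (auto elim: eventually_mono)
      ultimately show ?thesis by (rule LIMSEQ_unique)
    qed
    then show ?thesis using Y_Levi by (simp add: cpart_eq_0_iff)
  qed
  have "Levi b1 w * norm (b1 - a) \<le> - 4 * C * norm (r' b1)"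
  proof (rule tendsto_le[OF sequentially_bot])
    show "(\<lambda>k. Levi (Y k) w * norm (Y k - a)) \<longlonglongrightarrow> Levi b1 w * norm (b1 - a)"
      unfolding Levi_def by (intro tendsto_intros tr'' Y)
    show "(\<lambda>k. - 4 * C * norm (r' (Y k))) \<longlonglongrightarrow> - 4 * C * norm (r' b1)"
      by (intro tendsto_intros tr')
    show "\<forall>\<^sub>F k in sequentially. Levi (Y k) w * norm (Y k - a) \<le> - 4 * C * norm (r' (Y k))"
      using YU Y_Levi by (auto elim: eventually_mono)
  qed
  then have Ld: "Levi b1 w * d \<le> - 4 * C * norm (r' b1)" by (simp add: nb1)
  have Cn: "4 * C * norm (r' b1) > 0" using C nz by simp
  \<comment> \<open>If \<open>b1\<close> were \<open>a\<close>, the left side of \<open>Ld\<close>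
    would be 0 and the right side negative; this is where the Levi form would have to blow
    up.\<close>
  have d: "d > 0" using Ld Cn nb1 norm_ge_zero[of "b1 - a"] by (cases "d = 0") auto
  have L: "Levi b1 w \<le> - 4 * (C / d) * norm (r' b1)" using Ld d by (simp add: field_simps)
  have "Levi b1 w * d < 0" using Ld Cn by linarith
  then have neg: "Levi b1 w < 0" using d by (simp add: mult_less_0_iff)
  have disc: "inner_disc D c' b1 w" if "c' < C / d" for c'
    by (rule Levi_imp_inner_disc[OF b _ that w1 L]) (use C d in simp)
  obtain V where V: "open V" "b1 \<in> V" "V \<subseteq> U" and lev: "\<And>y. y \<in> V \<Longrightarrow> \<exists>v. cpart (r' y) v = 0 \<and> Levi y v < 0"
    by (rule Levi_negative_nearby[OF b(1) w1 neg nonzero[OF b]]) (rule that; assumption)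
  \<comment> \<open>The tangent direction with negative Levi form may vary with \<open>y\<close>;
    the conclusion about \<open>y - a\<close> does not depend on it.\<close>
  have tang: "r' y (y - a) = 0" if "y \<in> V" "r y = 0" for y
    using lev[OF that(1)] exceptional_point_complex_tangent[OF D(1) _ that(2) _ _ a] that V
    by (metis cpart_eq_0_iff subsetD)
  obtain \<rho> \<epsilon> where \<rho>: "\<rho> > 0" and \<epsilon>: "0 < \<epsilon>" "\<epsilon> < 1"
    and cone: "\<And>y l. y \<in> ball b1 \<rho> \<Longrightarrow> 1 - \<epsilon> \<le> l \<Longrightarrow> l \<le> 1 \<Longrightarrow> a + l *\<^sub>R (y - a) \<in> U \<and> sgn (r (a + l *\<^sub>R (y - a))) = sgn (r y)"
    by (rule local_cone[OF b V tang]) (assumption | (rule that; assumption))+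
  define l where "l = 1 - \<epsilon>"
  have l: "0 < l" "l < 1" "1 - \<epsilon> \<le> l" using \<epsilon> by (simp_all add: l_def)
  define b2 where "b2 = a + l *\<^sub>R (b1 - a)"
  have n2: "norm (b2 - a) = l * d" using l by (simp add: b2_def nb1)
  have "b2 \<in> U" "sgn (r b2) = 0"
    using cone[of b1 l] l \<rho> b by (auto simp: b2_def)
  then have f2: "b2 \<in> frontier D" using frontier by (simp add: sgn_zero_iff)
  have dil: "a + l *\<^sub>R (y - a) \<in> D" if "y \<in> ball b1 \<rho>" "y \<in> D" "y \<in> U" for y
    using cone[OF that(1) l(3) less_imp_le[OF l(2)]] that inside by (metis sgn_less)
  obtain \<rho>' where \<rho>': "\<rho>' > 0" "ball b1 \<rho>' \<subseteq> U" using open_U bU openE by blast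
  \<comment> \<open>Dilation turns the bound \<open>C / d\<close> into \<open>C / (l * d)\<close>,
    and \<open>b2\<close> lies at distance \<open>l * d\<close>: the condition defining
    \<open>M\<close> persists strictly closer to \<open>a\<close>.\<close>
  have "inner_disc D c' b2 w" if c': "c' < C / norm (b2 - a)" for c'
  proof -
    have "c' * l < C / d" using c' l d by (simp add: n2 field_simps)
    then have "inner_disc D (c' * l / l) b2 w"
      unfolding b2_def using \<rho> \<rho>' dil
      by (intro inner_disc_dilate[of "min \<rho> \<rho>'" l b1] disc l) auto
    then show ?thesis using l by simp
  qed
  then have "b2 \<in> M" using f2 n2 l d by (auto simp: M_def)
  then have "d \<le> l * d" using d_le n2 by metis
  then show False using l d by simp
qed

section \<open>Plane sections of pseudoconvex sets\<close>

text \<open>Affine discs are carried to affine discs, so the exhaustion function can be pulled back;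
  injectivity bounds \<open>L\<close> from below and thereby keeps the preimages of compact sublevel
  sets bounded.\<close>

lemma pseudoconvex_vimage_affine:
  fixes L :: "complex ^ 'm \<Rightarrow> complex ^ 'n"
  assumes psc: "pseudoconvex D" and L: "Vector_Spaces.linear (*s) (*s) L" "inj L"
  shows "pseudoconvex {z. p + L z \<in> D}"
proof -
  obtain u where D: "open D" and psh: "continuous_psh_on D u" and cpt: "\<And>c. compact {z \<in> D. u z \<le> c}"
    using psc unfolding pseudoconvex_def by blast
  have L_add: "L (x + y) = L x + L y" and L_scale: "L (k *s x) = k *s L x" for x y k
    using L(1) unfolding Vector_Spaces.linear_iff by auto
  have lin: "linear L"
    by (rule linearI) (simp_all add: L_add L_scale flip: smult_of_real)
  have contL: "continuous_on X L" for X
    using lin by (simp add: linear_continuous_on linear_conv_bounded_linear)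
  define f where "f = (\<lambda>z. p + L z)"
  have contf: "continuous_on X f" for X unfolding f_def by (intro continuous_intros contL)
  obtain B where B: "B > 0" "\<And>x. B * norm x \<le> norm (L x)"
    using linear_inj_bounded_below_pos[OF lin L(2)] by blast
  define \<Omega> where "\<Omega> = {z. f z \<in> D}"
  have "open \<Omega>" unfolding \<Omega>_def using open_vimage[OF D contf] by (simp add: vimage_def)
  moreover have "continuous_psh_on \<Omega> (u \<circ> f)"
    unfolding continuous_psh_on_def
  proof (intro conjI allI impI)
    have "continuous_on D u" using psh by (simp add: continuous_psh_on_def)
    then show "continuous_on \<Omega> (u \<circ> f)"
      unfolding o_def by (rule continuous_on_compose2[OF _ contf]) (auto simp: \<Omega>_def)
    fix z w assume "\<forall>\<zeta>\<in>cball 0 1. z + \<zeta> *s w \<in> \<Omega>"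
    then have "\<forall>\<zeta>\<in>cball 0 1. f z + \<zeta> *s L w \<in> D"
      by (simp add: \<Omega>_def f_def L_add L_scale add.assoc)
    then have "u (f z) \<le> 1 / (2 * pi) * integral {0..2 * pi} (\<lambda>t. u (f z + cis t *s L w))"
      using psh unfolding continuous_psh_on_def by blast
    then show "(u \<circ> f) z \<le> 1 / (2 * pi) * integral {0..2 * pi} (\<lambda>t. (u \<circ> f) (z + cis t *s w))"
      by (simp add: f_def L_add L_scale add.assoc)
  qed
  moreover have "compact {z \<in> \<Omega>. (u \<circ> f) z \<le> c}" for c
  proof -
    define S where "S = {z \<in> D. u z \<le> c}"
    have S: "compact S" using cpt by (simp add: S_def)
    have eq: "{z \<in> \<Omega>. (u \<circ> f) z \<le> c} = f -` S" by (auto simp: \<Omega>_def S_def)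
    obtain R where R: "\<And>y. y \<in> S \<Longrightarrow> norm y \<le> R" using compact_imp_bounded[OF S] by (auto simp: bounded_iff)
    have "norm z \<le> (R + norm p) / B" if "z \<in> f -` S" for z
    proof -
      have "B * norm z \<le> norm (f z - p)" using B(2)[of z] by (simp add: f_def)
      also have "\<dots> \<le> R + norm p" using norm_triangle_ineq4[of "f z" p] R[of "f z"] that by simp
      finally show ?thesis using B(1) by (simp add: pos_le_divide_eq mult.commute)
    qed
    then have "bounded (f -` S)" by (auto simp: bounded_iff)
    moreover have "closed (f -` S)" by (intro closed_vimage compact_imp_closed[OF S] contf)
    ultimately show ?thesis unfolding eq compact_eq_bounded_closed by blast
  qed
  ultimately have "pseudoconvex \<Omega>" unfolding pseudoconvex_def by blast
  then show ?thesis by (simp add: \<Omega>_def f_def)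
qed

text \<open>A basis of the direction space parametrises the plane, and the section becomes an affine
  preimage of \<open>D\<close>.\<close>

lemma pseudoconvex_imp_exceptional_point:
  assumes "pseudoconvex D"
  shows "exceptional_point a D"
  unfolding exceptional_point_def
proof (intro allI impI disjI2)
  fix P assume "complex_plane P \<and> a \<in> P"
  then obtain p V where V: "vec.subspace V" "vec.dim V = 2" and P: "P = (\<lambda>v. p + v) ` V"
    unfolding complex_plane_def by blast
  obtain B where B: "B \<subseteq> V" "vec.independent B" "V \<subseteq> vec.span B" "card B = 2"
    using vec.basis_exists[of V] V(2) by metis
  obtain x y where xy: "B = {x, y}" "x \<noteq> y" using B(4) by (auto simp: card_2_iff)
  have span: "vec.span {x, y} = V"
    using B V(1) xy(1) by (simp add: vec.span_minimal subset_antisym)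
  define L where "L = (\<lambda>z :: complex ^ 2. z $ 1 *s x + z $ 2 *s y)"
  have lin: "Vector_Spaces.linear (*s) (*s) L"
    unfolding Vector_Spaces.linear_iff
    by (auto simp: L_def vec.vector_space_axioms vector_sadd_rdistrib vector_add_ldistrib vector_smult_assoc)
  have "z = 0" if "L z = 0" for z
  proof -
    have y: "y \<noteq> 0" "x \<notin> vec.span {y}"
      using B(2) xy by (auto simp: vec.independent_insert)
    have z1: "z $ 1 = 0"
    proof (rule ccontr)
      assume nz: "z $ 1 \<noteq> 0"
      have "z $ 1 *s x = (- z $ 2) *s y" using that by (simp add: L_def eq_neg_iff_add_eq_0)
      then have "inverse (z $ 1) *s (z $ 1 *s x) = inverse (z $ 1) *s ((- z $ 2) *s y)" by simp
      then have "x = (inverse (z $ 1) * (- z $ 2)) *s y"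
        using nz by (simp add: vector_smult_assoc)
      then show False using y(2) unfolding vec.span_singleton by blast
    qed
    then have "z $ 2 = 0" using that y(1) by (simp add: L_def)
    with z1 show ?thesis by (simp add: vec_eq_iff forall_2)
  qed
  moreover have "L (u - v) = L u - L v" for u v
    by (simp add: L_def vector_ssub_ldistrib algebra_simps)
  ultimately have inj: "inj L" by (metis injI right_minus_eq)
  have range: "range L = V"
  proof -
    have "range L = vec.span {x, y}"
    proof (intro equalityI subsetI)
      fix v assume "v \<in> range L"
      then show "v \<in> vec.span {x, y}"
        by (auto simp: L_def intro!: vec.span_add vec.span_scale intro: vec.span_base)
    next
      fix v assume "v \<in> vec.span {x, y}"
      then obtain k j where "v - k *s x = j *s y"
        by (auto simp: vec.span_breakdown_eq[of _ x] vec.span_singleton)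
      then have "v = L (vector [k, j])" by (simp add: L_def algebra_simps)
      then show "v \<in> range L" by blast
    qed
    then show ?thesis by (simp add: span)
  qed
  have "bij_betw (\<lambda>z. p + L z) UNIV P"
    unfolding bij_betw_def P range[symmetric] using inj by (auto simp: inj_def)
  moreover have "{z. p + L z \<in> P \<inter> D} = {z. p + L z \<in> D}"
    using range by (auto simp: P)
  ultimately show "pseudoconvex_in_plane P (P \<inter> D)"
    unfolding pseudoconvex_in_plane_def using lin pseudoconvex_vimage_affine[OF assms lin inj, of p] by metis
qed

theorem corollary1:
  fixes D :: "(complex ^ 'n) set"
  assumes "open D" and "C2_smooth D"
  shows "pseudoconvex D \<longleftrightarrow> (\<exists>a. exceptional_point a D)"
  using pseudoconvex_imp_exceptional_point exceptional_point_no_inner_disc[OF assms]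
    pseudoconvexI_no_inner_disc[OF assms(1)] by blast

end
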